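(* Even for binary input strings, the naïve LZD construction algorithm and the naïve LZMW construction algorithm each take $\Omega(n^{5/4}/\log^{1/4} n)$ time in the worst case; that is, for arbitrarily large $n$ there are binary strings of length $n$ on which the algorithm runs in time $\Omega(n^{5/4}/\log^{1/4} n)$.
   Context: LZD parsing of $s[1..n]$: $s=p_1\cdots p_z$, where with $k=|p_1\cdots p_{i-1}|+1$, $p_i=p_{i_1}p_{i_2}$ with $p_{i_1}$ the longest prefix of $s[k..n]$ in $\{p_1,\dots,p_{i-1}\}\cup\Sigma$ and $p_{i_2}$ the longest prefix of $s[k+|p_{i_1}|..n]$ in that set. LZMW parsing: $p_i$ is the longest prefix of $s[k..n]$ in $\{p_jp_{j+1}:1\le j\le i-2\}\cup\Sigma$. The naïve LZD algorithm maintains a compacted trie (edge labels stored as pairs of positions into the input) containing the phrases computed so far and the distinct letters seen so far, with these nodes marked. To find each component $p_{i_1}$ (resp. $p_{i_2}$) starting at position $j$, it traverses the trie from the root comparing letters of $s[j..n]$ with edge labels as far as the match extends, and takes the string of the lowest marked node on the matched path (a first occurrence of a letter is inserted as a new marked child of the root). After computing $p_i$ it inserts $p_i$ into the trie by a root-to-node traversal, creating at most two nodes and marking the node of $p_i$. The naïve LZMW algorithm is identical except that the trie contains (marked) the strings $p_1p_2,\dots,p_{i-2}p_{i-1}$ and the letters, and one longest marked match is taken per phrase. Running time counts all letter comparisons and trie-edge traversals. *)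

theory Defs
  imports Complex_Main
begin

text \<open>
  Positions are 0-based and \<open>slice s b e\<close> is the factor of \<open>s\<close> at positions \<open>b, \<dots>, e - 1\<close>.
\<close>

definition slice :: "'a list \<Rightarrow> nat \<Rightarrow> nat \<Rightarrow> 'a list" where
  "slice s b e = drop b (take e s)"

text \<open>
  A compacted trie. A node carries its mark and the list of its outgoing edges; an edge
  \<open>(b, e, t)\<close> leads to the node \<open>t\<close> and its label \<open>slice s b e\<close> is stored as a pair of positions
  of the input \<open>s\<close>. The edges leaving a node have labels with distinct first letters (this holds
  for all tries built by the algorithms below).
\<close>

datatype trie = Node bool "(nat \<times> nat \<times> trie) list"

text \<open>
  Letter-by-letter comparison of two strings up to the first mismatch or the end of one of them:
  the number of matching letters and the number of letter comparisons made.
\<close>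

fun compare_letters :: "'a list \<Rightarrow> 'a list \<Rightarrow> nat \<times> nat" where
  "compare_letters (x # xs) (y # ys) =
     (if x = y then (case compare_letters xs ys of (q, c) \<Rightarrow> (q + 1, c + 1)) else (0, 1))"
| "compare_letters _ _ = (0, 0)"

text \<open>
  Traversal of the trie with the text \<open>s\<close> read from position \<open>i\<close> on, as far as the match extends.
  The argument \<open>best\<close> is the text position reached at the lowest marked node met so far; the result
  is its final value together with the cost. The edge to follow is found by comparing the current
  text letter with the first letters of the outgoing edges one after the other. The cost is the
  number of letter comparisons (successful or not) plus the number of edges entered, so that
  following an edge costs 2 (its traversal and the comparison with the first letter of its label)
  plus the comparisons with the remaining letters of its label.
\<close>

fun descend :: "'a list \<Rightarrow> nat \<Rightarrow> nat \<Rightarrow> trie \<Rightarrow> nat \<times> nat"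
  and descend_edges :: "'a list \<Rightarrow> nat \<Rightarrow> nat \<Rightarrow> (nat \<times> nat \<times> trie) list \<Rightarrow> nat \<times> nat"
where
  "descend s i best (Node m es) =
     (let best' = (if m then i else best)
      in if i < length s then descend_edges s i best' es else (best', 0))"
| "descend_edges s i best [] = (best, 0)"
| "descend_edges s i best ((b, e, t) # es) =
     (if s ! b = s ! i then
        (case compare_letters (slice s (b + 1) e) (slice s (i + 1) (length s)) of (q, c) \<Rightarrow>
           if b + 1 + q = e then
             (case descend s (i + 1 + q) best t of (r, c') \<Rightarrow> (r, 2 + c + c'))
           else (best, 2 + c))
      else (case descend_edges s i best es of (r, c) \<Rightarrow> (r, 1 + c)))"

text \<open>
  Insertion of the string \<open>slice s b e\<close> below a node, with the same cost measure. An edge whose label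
  is matched only in part is split.
\<close>

fun insert_string :: "'a list \<Rightarrow> nat \<Rightarrow> nat \<Rightarrow> trie \<Rightarrow> trie \<times> nat"
  and insert_edges ::
    "'a list \<Rightarrow> nat \<Rightarrow> nat \<Rightarrow> (nat \<times> nat \<times> trie) list \<Rightarrow> (nat \<times> nat \<times> trie) list \<times> nat"
where
  "insert_string s b e (Node m es) =
     (if b < e then (case insert_edges s b e es of (es', c) \<Rightarrow> (Node m es', c))
      else (Node True es, 0))"
| "insert_edges s b e [] = ([(b, e, Node True [])], 0)"
| "insert_edges s b e ((b', e', t) # es) =
     (if s ! b' = s ! b then
        (case compare_letters (slice s (b' + 1) e') (slice s (b + 1) e) of (q, c) \<Rightarrow>
           let i = b + 1 + q; i' = b' + 1 + q
           in if i' = e' then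
                (case insert_string s i e t of (t', c') \<Rightarrow> ((b', e', t') # es, 2 + c + c'))
              else if i = e then
                ((b', i', Node True [(i', e', t)]) # es, 2 + c)
              else
                ((b', i', Node False [(i', e', t), (i, e, Node True [])]) # es, 2 + c))
      else (case insert_edges s b e es of (es', c) \<Rightarrow> ((b', e', t) # es', 1 + c)))"

fun insert_letter :: "nat \<Rightarrow> trie \<Rightarrow> trie" where
  "insert_letter j (Node m es) = Node m (es @ [(j, j + 1, Node True [])])"

text \<open>
  The longest marked match at position \<open>j\<close>: its end position, the resulting trie and the cost.
  The letters seen so far are marked, so the search returns the position \<open>j\<close> itself only if the
  letter at \<open>j\<close> occurs for the first time.
\<close>

definition longest_marked :: "'a list \<Rightarrow> trie \<Rightarrow> nat \<Rightarrow> nat \<times> trie \<times> nat" where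
  "longest_marked s T j =
     (case descend s j j T of (r, c) \<Rightarrow>
        if j < r then (r, T, c) else (j + 1, insert_letter j T, c))"

lemma longest_marked_progress: "(r, T', c) = longest_marked s T j \<Longrightarrow> j < r"
  by (auto simp: longest_marked_def split: prod.splits if_splits)

text \<open>
  The main loops, started with the trie \<open>T\<close> at text position \<open>k\<close>; the result is the list of the
  remaining phrases and the running time. The second component of the last LZD phrase is empty if
  the first one already ends at the end of the text.
\<close>

function lzd_loop :: "'a list \<Rightarrow> trie \<Rightarrow> nat \<Rightarrow> 'a list list \<times> nat" where
  "lzd_loop s T k =
     (if k < length s then
        (case longest_marked s T k of (k1, T1, c1) \<Rightarrow>
         case (if k1 < length s then longest_marked s T1 k1 else (k1, T1, 0)) of (k2, T2, c2) \<Rightarrow>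
         case insert_string s k k2 T2 of (T3, c3) \<Rightarrow>
         case lzd_loop s T3 k2 of (ps, c) \<Rightarrow> (slice s k k2 # ps, c1 + c2 + c3 + c))
      else ([], 0))"
  by pat_completeness auto
termination
  by (relation "measure (\<lambda>(s, T, k). length s - k)")
    (auto dest!: longest_marked_progress split: if_splits intro: diff_less_mono2 order.strict_trans)

text \<open>
  In the LZMW loop, \<open>prev\<close> is the starting position of the previous phrase, if any: once a phrase
  has been computed, its concatenation with the previous one is inserted.
\<close>

function lzmw_loop :: "'a list \<Rightarrow> trie \<Rightarrow> nat option \<Rightarrow> nat \<Rightarrow> 'a list list \<times> nat" where
  "lzmw_loop s T prev k =
     (if k < length s then
        (case longest_marked s T k of (k1, T1, c1) \<Rightarrow>
         case (case prev of None \<Rightarrow> (T1, 0) | Some h \<Rightarrow> insert_string s h k1 T1) of (T2, c2) \<Rightarrow>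
         case lzmw_loop s T2 (Some k) k1 of (ps, c) \<Rightarrow> (slice s k k1 # ps, c1 + c2 + c))
      else ([], 0))"
  by pat_completeness auto
termination
  by (relation "measure (\<lambda>(s, T, prev, k). length s - k)")
    (auto dest!: longest_marked_progress intro: diff_less_mono2)

declare lzd_loop.simps [simp del] lzmw_loop.simps [simp del]

definition naive_lzd :: "'a list \<Rightarrow> 'a list list \<times> nat" where
  "naive_lzd s = lzd_loop s (Node False []) 0"

definition naive_lzmw :: "'a list \<Rightarrow> 'a list list \<times> nat" where
  "naive_lzmw s = lzmw_loop s (Node False []) None 0"

definition naive_lzd_time :: "'a list \<Rightarrow> nat" where
  "naive_lzd_time s = snd (naive_lzd s)"

definition naive_lzmw_time :: "'a list \<Rightarrow> nat" where
  "naive_lzmw_time s = snd (naive_lzmw s)"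

end

theory Submission
  imports Defs "HOL-Library.Sublist"
begin

text \<open>
  Letters are natural numbers, coded in binary as \<open>0\<^sup>a1\<close>; after a preamble that turns all codes into
  dictionary entries, both algorithms parse coded texts letter by letter. Let
  \<open>u = e\<^sub>0 y\<^sub>1 e\<^sub>1 \<dots> y\<^sub>K e\<^sub>K\<close> and let the core be \<open>x\<^sub>K\<^sub>-\<^sub>1 u h\<^sub>K\<^sub>-\<^sub>1 \<dots> x\<^sub>0 u h\<^sub>0\<close>. First every suffix of the core
  starting with some \<open>x\<^sub>m\<close>, followed by a terminator, is made a dictionary entry. Then there are \<open>K\<close>
  rounds: round \<open>j\<close> inserts \<open>x\<^sub>m e\<^sub>0 y\<^sub>1 \<dots> e\<^sub>j\<close> for all \<open>m\<close> and reads the core once. At each \<open>x\<^sub>m\<close> the search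
  runs down the long entry to the end of the core, but only \<open>x\<^sub>m e\<^sub>0 y\<^sub>1 \<dots> e\<^sub>j\<close> is taken; then the single letter
  \<open>y\<^sub>j\<^sub>+\<^sub>1\<close>; then an exit phrase \<open>e\<^sub>j\<^sub>+\<^sub>1 \<dots> e\<^sub>K\<close> brings the parse to the next \<open>x\<close>. So all damage done to
  the dictionary is the prolongation of the entries at \<open>x\<^sub>m\<close> by one letter. Every piece of text is
  isolated from the next by fresh separators. Codes have length of order \<open>K\<close>, hence the text has length
  \<open>O(K\<^sup>4)\<close>, and the \<open>K\<^sup>2\<close> long searches cost of order \<open>K\<^sup>3\<close> each.
\<close>

section \<open>Tries as dictionaries\<close>

text \<open>From \<open>lzd_lb\<close> and \<open>lzmw_lb\<close> on, a trie is known only to be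
  well formed and to have this set of marked strings; its shape is forgotten.\<close>

fun marked :: "'a list \<Rightarrow> trie \<Rightarrow> 'a list set"
  and marked_edges :: "'a list \<Rightarrow> (nat \<times> nat \<times> trie) list \<Rightarrow> 'a list set"
where
  "marked s (Node m es) = (if m then {[]} else {}) \<union> marked_edges s es"
| "marked_edges s [] = {}"
| "marked_edges s ((b, e, t) # es) = (@) (slice s b e) ` marked s t \<union> marked_edges s es"

fun wf_trie :: "'a list \<Rightarrow> trie \<Rightarrow> bool"
  and wf_edges :: "'a list \<Rightarrow> (nat \<times> nat \<times> trie) list \<Rightarrow> bool"
where
  "wf_trie s (Node m es) = wf_edges s es"
| "wf_edges s [] = True"
| "wf_edges s ((b, e, t) # es) =
     (b < e \<and> e \<le> length s \<and> wf_trie s t \<and> wf_edges s es \<and> s ! b \<notin> (\<lambda>x. s ! fst x) ` set es)"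

definition is_longest :: "'a list set \<Rightarrow> 'a list \<Rightarrow> 'a list \<Rightarrow> bool" where
  "is_longest D w u \<longleftrightarrow> u \<in> D \<and> prefix u w \<and> (\<forall>d\<in>D. prefix d w \<longrightarrow> length d \<le> length u)"

lemma slice_Cons: "b < e \<Longrightarrow> e \<le> length s \<Longrightarrow> slice s b e = s ! b # slice s (b + 1) e"
  by (simp add: slice_def Cons_nth_drop_Suc[symmetric])

lemma slice_length: "slice s b (length s) = drop b s"
  by (simp add: slice_def)

lemma length_slice: "e \<le> length s \<Longrightarrow> length (slice s b e) = e - b"
  by (simp add: slice_def)

lemma slice_append: "b \<le> i \<Longrightarrow> i \<le> e \<Longrightarrow> slice s b i @ slice s i e = slice s b e"
  using take_add[of "i - b" "e - i" "drop b s"] by (simp add: slice_def drop_take)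

lemma compare_letters_correct:
  assumes "compare_letters xs ys = (q, c)"
  shows "q \<le> c" "q \<le> length xs" "q \<le> length ys" "take q xs = take q ys"
    "q < length xs \<Longrightarrow> q < length ys \<Longrightarrow> xs ! q \<noteq> ys ! q"
proof -
  have "q \<le> c \<and> q \<le> length xs \<and> q \<le> length ys \<and> take q xs = take q ys \<and>
    (q < length xs \<longrightarrow> q < length ys \<longrightarrow> xs ! q \<noteq> ys ! q)"
    using assms
    by (induction xs ys arbitrary: q c rule: compare_letters.induct)
      (auto split: if_splits prod.splits)
  then show "q \<le> c" "q \<le> length xs" "q \<le> length ys" "take q xs = take q ys"
    "q < length xs \<Longrightarrow> q < length ys \<Longrightarrow> xs ! q \<noteq> ys ! q" by auto
qed

lemma common_prefix_le_compare_letters: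
  assumes "compare_letters xs ys = (q, c)" "prefix z xs" "prefix z ys"
  shows "length z \<le> q"
proof (rule ccontr)
  assume *: "\<not> ?thesis"
  then have "q < length xs" "q < length ys"
    using assms prefix_length_le by force+
  moreover have "xs ! q = ys ! q"
    using assms * by (auto simp: prefix_def nth_append)
  ultimately show False
    using compare_letters_correct(5)[OF assms(1)] by simp
qed

section \<open>Search and insertion as operations on a set of strings\<close>

lemma hd_marked_edges:
  "wf_edges s es \<Longrightarrow> d \<in> marked_edges s es \<Longrightarrow> d \<noteq> [] \<and> hd d \<in> (\<lambda>x. s ! fst x) ` set es"
  by (induction es) (auto simp: slice_Cons)

text \<open>The last clause is the source of the lower bound: the search pays for every letter that
  the text shares with any entry, even if that entry does not match to its end and a much shorter
  one is returned. An entry sharing a nonempty prefix with the text lies below the only edge that is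
  followed.\<close>

lemma descend_correct:
  "wf_trie s T \<Longrightarrow> descend s i best T = (r, c) \<Longrightarrow>
    (\<forall>u. is_longest (marked s T) (drop i s) u \<longrightarrow> r = i + length u) \<and>
    ((\<forall>d\<in>marked s T. \<not> prefix d (drop i s)) \<longrightarrow> r = best) \<and>
    (\<forall>d\<in>marked s T. \<forall>z. prefix z d \<longrightarrow> prefix z (drop i s) \<longrightarrow> length z \<le> c)"
  "wf_edges s es \<Longrightarrow> i < length s \<Longrightarrow> descend_edges s i best es = (r, c) \<Longrightarrow>
    (\<forall>u. is_longest (marked_edges s es) (drop i s) u \<longrightarrow> r = i + length u) \<and>
    ((\<forall>d\<in>marked_edges s es. \<not> prefix d (drop i s)) \<longrightarrow> r = best) \<and>
    (\<forall>d\<in>marked_edges s es. \<forall>z. prefix z d \<longrightarrow> prefix z (drop i s) \<longrightarrow> length z \<le> c)"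
proof (induction s i best T and s i best es arbitrary: r c and r c rule: descend_descend_edges.induct)
  case (1 s i best m es)
  show ?case
  proof (cases "i < length s")
    case True
    define best' where "best' = (if m then i else best)"
    have wf: "wf_edges s es" using 1 by simp
    have *: "(\<forall>u. is_longest (marked_edges s es) (drop i s) u \<longrightarrow> r = i + length u) \<and>
    ((\<forall>d\<in>marked_edges s es. \<not> prefix d (drop i s)) \<longrightarrow> r = best') \<and>
    (\<forall>d\<in>marked_edges s es. \<forall>z. prefix z d \<longrightarrow> prefix z (drop i s) \<longrightarrow> length z \<le> c)"
      using 1 True by (simp add: best'_def)
    have A: "r = i + length u" if u: "is_longest (marked s (Node m es)) (drop i s) u" for u
    proof (cases "u = []")
      case False
      then have "is_longest (marked_edges s es) (drop i s) u"
        using u by (auto simp: is_longest_def split: if_splits)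
      then show ?thesis using * by blast
    next
      case True
      \<comment> \<open>Entries below edges are nonempty, so if the longest match is empty, none of
        them matches and the search falls back to this marked node.\<close>
      have "\<not> prefix d (drop i s)" if "d \<in> marked_edges s es" for d
        using u True that hd_marked_edges[OF wf that] by (auto simp: is_longest_def)
      moreover have m using u True hd_marked_edges[OF wf, of "[]"]
        by (auto simp: is_longest_def split: if_splits)
      ultimately show ?thesis using * True by (simp add: best'_def)
    qed
    have B: "r = best" if "\<forall>d\<in>marked s (Node m es). \<not> prefix d (drop i s)"
      using that * by (auto simp: best'_def split: if_splits)
    show ?thesis using A B * by auto
  next
    case False
    then have "r = (if m then i else best)" "drop i s = []" using 1 by (auto simp: Let_def)
    moreover have "[] \<notin> marked_edges s es"
      using hd_marked_edges[of s es "[]"] 1 by auto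
    ultimately show ?thesis by (auto simp: is_longest_def split: if_splits)
  qed
next
  case (2 s i best)
  then show ?case by (auto simp: is_longest_def)
next
  case (3 s i best b e t es)
  have wf: "b < e" "e \<le> length s" "wf_trie s t" "wf_edges s es"
    "s ! b \<notin> (\<lambda>x. s ! fst x) ` set es" using 3 by auto
  have drop: "drop i s = s ! i # drop (i + 1) s"
    using 3 by (simp add: Cons_nth_drop_Suc)
  have lab: "slice s b e = s ! b # slice s (b + 1) e" using wf by (simp add: slice_Cons)
  show ?case
  proof (cases "s ! b = s ! i")
    case False
    then have ne: "z = []" if "prefix z (slice s b e @ d)" "prefix z (drop i s)" for d z
      using that unfolding drop lab by (cases z) auto
    have ne': "\<not> prefix (slice s b e @ d) (drop i s)" for d
      using ne[of "slice s b e @ d" d] by (auto simp: lab)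
    obtain c' where c': "descend_edges s i best es = (r, c')" "c = 1 + c'"
      using 3(5) False by (auto split: prod.splits)
    have IH: "(\<forall>u. is_longest (marked_edges s es) (drop i s) u \<longrightarrow> r = i + length u) \<and>
    ((\<forall>d\<in>marked_edges s es. \<not> prefix d (drop i s)) \<longrightarrow> r = best) \<and>
    (\<forall>d\<in>marked_edges s es. \<forall>z. prefix z d \<longrightarrow> prefix z (drop i s) \<longrightarrow> length z \<le> c')"
      using 3(2)[OF False wf(4) 3(4) c'(1)] .
    have "is_longest (marked_edges s es) (drop i s) u"
      if "is_longest (marked_edges s ((b, e, t) # es)) (drop i s) u" for u
      using that ne' by (auto simp: is_longest_def)
    moreover have "length z \<le> c" if dz: "d \<in> marked_edges s ((b, e, t) # es)" "prefix z d" "prefix z (drop i s)" for d z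
    proof (cases "d \<in> marked_edges s es")
      case True
      then show ?thesis using IH dz c'(2) by fastforce
    next
      case False
      then obtain d' where "d = slice s b e @ d'" using dz(1) by auto
      then have "z = []" using ne dz by blast
      then show ?thesis by simp
    qed
    ultimately show ?thesis using IH by auto
  next
    case True
    \<comment> \<open>The other edges start with another letter, so their entries share only the
      empty prefix with the text.\<close>
    have sib: "z = []" if "d \<in> marked_edges s es" "prefix z d" "prefix z (drop i s)" for d z
    proof (rule ccontr)
      assume "z \<noteq> []"
      then have "hd d = s ! i" using that unfolding drop by (cases z; cases d) auto
      then show False using hd_marked_edges[OF wf(4) that(1)] wf(5) True by auto
    qed
    have sib0: "length z \<le> n" if "d \<in> marked_edges s es" "prefix z d" "prefix z (drop i s)" for d z n
      using sib[OF that] by simp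
    have sib': "\<not> prefix d (drop i s)" if "d \<in> marked_edges s es" for d
      using sib[OF that, of d] hd_marked_edges[OF wf(4) that] by auto
    obtain q c1 where qc: "compare_letters (slice s (b + 1) e) (slice s (i + 1) (length s)) = (q, c1)"
      by fastforce
    note cmp = compare_letters_correct[OF qc]
    have len: "length (slice s (b + 1) e) = e - (b + 1)" using wf by (simp add: length_slice)
    have zq: "length z \<le> q" if "prefix z (slice s (b + 1) e)" "prefix z (drop (i + 1) s)" for z
      using common_prefix_le_compare_letters[OF qc] that by (simp add: slice_length)
    show ?thesis
    proof (cases "b + 1 + q = e")
      case full: True
      obtain c2 where c2: "descend s (i + 1 + q) best t = (r, c2)" "c = 2 + c1 + c2"
        using 3(5) True qc full by (auto split: prod.splits)
      have IH: "(\<forall>u. is_longest (marked s t) (drop (i + 1 + q) s) u \<longrightarrow> r = i + 1 + q + length u) \<and>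
    ((\<forall>d\<in>marked s t. \<not> prefix d (drop (i + 1 + q) s)) \<longrightarrow> r = best) \<and>
    (\<forall>d\<in>marked s t. \<forall>z. prefix z d \<longrightarrow> prefix z (drop (i + 1 + q) s) \<longrightarrow> length z \<le> c2)"
        using 3(1)[OF True qc[symmetric] full wf(3) c2(1)] .
      have "slice s (b + 1) e = take q (drop (i + 1) s)"
        using cmp(4) len full by (simp add: slice_length)
      then have split: "drop i s = slice s b e @ drop (i + 1 + q) s"
        unfolding lab drop True
        by (metis (no_types, opaque_lifting) add.commute append_Cons append_take_drop_id drop_drop)
      have ll: "length (slice s b e) = 1 + q" using wf full by (simp add: length_slice)
      have A: "r = i + length u"
        if u: "is_longest (marked_edges s ((b, e, t) # es)) (drop i s) u" for u
      proof -
        obtain v where v: "u = slice s b e @ v" "v \<in> marked s t"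
          using u sib' by (auto simp: is_longest_def)
        have "is_longest (marked s t) (drop (i + 1 + q) s) v"
          using u v unfolding is_longest_def split by (auto simp: ball_Un)
        then show ?thesis using IH v ll by auto
      qed
      have B: "r = best" if "\<forall>d\<in>marked_edges s ((b, e, t) # es). \<not> prefix d (drop i s)"
        using that IH unfolding split by (auto simp: ball_Un)
      have C: "length z \<le> c" if dz: "d \<in> marked s t" "prefix z (slice s b e @ d)" "prefix z (drop i s)" for d z
      proof (cases "prefix z (slice s b e)")
        case True
        then show ?thesis using ll prefix_length_le[OF True] c2(2) cmp(1) by simp
      next
        case False
        then obtain y where y: "z = slice s b e @ y" "prefix y d"
          using dz(2) by (auto simp: prefix_append)
        then have "length y \<le> c2" using IH dz unfolding split by auto
        then show ?thesis using y ll c2(2) cmp(1) by simp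
      qed
      have "length z \<le> c" if "d \<in> marked_edges s ((b, e, t) # es)" "prefix z d" "prefix z (drop i s)" for d z
        using that by (auto intro: C sib0)
      then show ?thesis using A B by blast
    next
      case part: False
      have rc: "r = best" "c = 2 + c1" using 3(5) True qc part by (auto split: prod.splits)
      \<comment> \<open>A label that matched completely would have been counted completely by the
        comparison. So no entry below this edge matches, and every common prefix ends inside the
        label.\<close>
      have nopre: "\<not> prefix (slice s b e) (drop i s)"
      proof
        assume "prefix (slice s b e) (drop i s)"
        then have "prefix (slice s (b + 1) e) (drop (i + 1) s)" unfolding lab drop by simp
        then have "e - (b + 1) \<le> q" using zq len by fastforce
        then show False using cmp(2) len part wf by simp
      qed
      then have nopre': "\<not> prefix (slice s b e @ d) (drop i s)" for d
        using append_prefixD by blast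
      have C: "length z \<le> c" if "prefix z (slice s b e @ d)" "prefix z (drop i s)" for d z
      proof -
        have "prefix z (slice s b e)"
          using that nopre by (auto simp: prefix_append append_prefixD)
        then have "length z \<le> 1 + q"
          using that(2) zq[of "tl z"] unfolding lab drop by (cases z) auto
        then show ?thesis using rc cmp(1) by simp
      qed
      have "\<not> is_longest (marked_edges s ((b, e, t) # es)) (drop i s) u" for u
        using sib' nopre' by (auto simp: is_longest_def)
      moreover have "length z \<le> c" if "d \<in> marked_edges s ((b, e, t) # es)" "prefix z d" "prefix z (drop i s)" for d z
        using that by (auto intro: C sib0)
      ultimately show ?thesis using rc(1) by blast
    qed
  qed
qed

text \<open>The clause on first letters carries the induction: an edge list gains no first letter
  but that of the inserted string, so earlier edges stay distinguishable.\<close>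

lemma insert_correct:
  "wf_trie s T \<Longrightarrow> b \<le> e \<Longrightarrow> e \<le> length s \<Longrightarrow> insert_string s b e T = (T', c) \<Longrightarrow>
    wf_trie s T' \<and> marked s T' = insert (slice s b e) (marked s T)"
  "wf_edges s es \<Longrightarrow> b < e \<Longrightarrow> e \<le> length s \<Longrightarrow> insert_edges s b e es = (es', c) \<Longrightarrow>
    wf_edges s es' \<and> marked_edges s es' = insert (slice s b e) (marked_edges s es) \<and>
    (\<lambda>x. s ! fst x) ` set es' = insert (s ! b) ((\<lambda>x. s ! fst x) ` set es)"
proof (induction s b e T and s b e es arbitrary: T' c and es' c rule: insert_string_insert_edges.induct)
  case (1 s b e m es)
  show ?case
  proof (cases "b < e")
    case True
    then obtain es' where "insert_edges s b e es = (es', c)" "T' = Node m es'"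
      using 1 by (auto split: prod.splits)
    then show ?thesis using 1 True by auto
  next
    case False
    then have "slice s b e = []" by (simp add: slice_def)
    then show ?thesis using 1 False by auto
  qed
next
  case (2 s b e)
  then show ?case by auto
next
  case (3 s b e b' e' t es)
  have wf: "b' < e'" "e' \<le> length s" "wf_trie s t" "wf_edges s es"
    "s ! b' \<notin> (\<lambda>x. s ! fst x) ` set es" using 3 by auto
  show ?case
  proof (cases "s ! b' = s ! b")
    case False
    then obtain es'' c' where es'': "insert_edges s b e es = (es'', c')" "es' = (b', e', t) # es''"
      using 3(6) by (auto split: prod.splits)
    then show ?thesis
      using 3(2)[OF False wf(4) 3(4,5) es''(1)] wf False by auto
  next
    case True
    obtain q c1 where qc: "compare_letters (slice s (b' + 1) e') (slice s (b + 1) e) = (q, c1)"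
      by fastforce
    note cmp = compare_letters_correct[OF qc]
    have len: "length (slice s (b' + 1) e') = e' - (b' + 1)" "length (slice s (b + 1) e) = e - (b + 1)"
      using wf 3 by (simp_all add: length_slice)
    have q: "b' + 1 + q \<le> e'" "b + 1 + q \<le> e" using cmp(2,3) len wf 3 by auto
    have tk: "take q (slice s (x + 1) y) = slice s (x + 1) (x + 1 + q)" if "x + 1 + q \<le> y" for x y
      using that by (simp add: slice_def take_drop min_def add.commute)
    have "slice s (b' + 1) (b' + 1 + q) = slice s (b + 1) (b + 1 + q)"
      using cmp(4) tk q by metis
    then have eq: "slice s b' (b' + 1 + q) = slice s b (b + 1 + q)"
      using True q wf 3 by (simp add: slice_Cons)
    have sp: "slice s b e = slice s b' (b' + 1 + q) @ slice s (b + 1 + q) e"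
      unfolding eq using q by (intro slice_append[symmetric]) auto
    have sp': "slice s b' e' = slice s b' (b' + 1 + q) @ slice s (b' + 1 + q) e'"
      using q by (intro slice_append[symmetric]) auto
    consider "b' + 1 + q = e'" | "b' + 1 + q < e'" "b + 1 + q = e" | "b' + 1 + q < e'" "b + 1 + q < e"
      using q by linarith
    then show ?thesis
    proof cases
      case 1
      then obtain t' c2 where t': "insert_string s (b + 1 + q) e t = (t', c2)" "es' = (b', e', t') # es"
        using 3(6) True qc by (auto simp: Let_def split: prod.splits)
      have "wf_trie s t' \<and> marked s t' = insert (slice s (b + 1 + q) e) (marked s t)"
        using 3(1)[OF True qc[symmetric] refl refl 1 wf(3) q(2) 3(5) t'(1)] .
      then show ?thesis using t' wf sp 1 True by auto
    next
      case 2
      then have es': "es' = (b', b' + 1 + q, Node True [(b' + 1 + q, e', t)]) # es"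
        using 3(6) True qc by (auto simp: Let_def split: prod.splits)
      have "slice s b' (b' + 1 + q) = slice s b e" using eq 2 by simp
      then show ?thesis unfolding es' using wf 2 True sp'
        by (auto simp: image_iff)
    next
      case 3
      then have es': "es' = (b', b' + 1 + q,
          Node False [(b' + 1 + q, e', t), (b + 1 + q, e, Node True [])]) # es"
        using "3.prems"(4) True qc by (auto simp: Let_def split: prod.splits)
      \<comment> \<open>The two edges below the new inner node start with the letters at which the
        comparison stopped; as these differ, the trie stays well formed.\<close>
      have "slice s (b' + 1) e' ! q \<noteq> slice s (b + 1) e ! q"
        using cmp(5) len 3 by simp
      moreover have "slice s (b' + 1) e' ! q = s ! (b' + 1 + q)" "slice s (b + 1) e ! q = s ! (b + 1 + q)"
        using 3 wf "3.prems" by (simp_all add: slice_def)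
      ultimately show ?thesis unfolding es' using wf 3 True sp' sp "3.prems"
        by (auto simp: image_iff)
    qed
  qed
qed

section \<open>Remaining running time in terms of dictionary and unread text\<close>

definition lzd_lb :: "'a list set \<Rightarrow> 'a list \<Rightarrow> nat \<Rightarrow> bool" where
  "lzd_lb D w c \<longleftrightarrow> (\<forall>v T. wf_trie (v @ w) T \<longrightarrow> marked (v @ w) T = D \<longrightarrow>
     c \<le> snd (lzd_loop (v @ w) T (length v)))"

text \<open>As in \<open>lzd_lb\<close>, quantifying over the text \<open>v\<close> already read and
  over all tries with dictionary \<open>D\<close> leaves a statement on dictionary and unread text
  alone. Here \<open>p\<close> is the previous phrase, still to be joined with the next one.\<close>

definition lzmw_lb :: "'a list set \<Rightarrow> 'a list \<Rightarrow> 'a list \<Rightarrow> nat \<Rightarrow> bool" where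
  "lzmw_lb D p w c \<longleftrightarrow> (\<forall>v T. wf_trie (v @ p @ w) T \<longrightarrow> marked (v @ p @ w) T = D \<longrightarrow>
     c \<le> snd (lzmw_loop (v @ p @ w) T (Some (length v)) (length (v @ p))))"

definition agrees :: "'a list set \<Rightarrow> 'a list \<Rightarrow> nat \<Rightarrow> bool" where
  "agrees D w m \<longleftrightarrow> m = 0 \<or> (\<exists>d\<in>D. \<exists>z. prefix z d \<and> prefix z w \<and> m \<le> length z)"

lemma lzd_lb_0: "lzd_lb D w 0"
  by (simp add: lzd_lb_def)

lemma lzmw_lb_0: "lzmw_lb D p w 0"
  by (simp add: lzmw_lb_def)

lemma longest_marked_correct:
  assumes "wf_trie (v @ w) T" "is_longest (marked (v @ w) T) w u" "u \<noteq> []"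
    "agrees (marked (v @ w) T) w m"
  obtains c where "longest_marked (v @ w) T (length v) = (length v + length u, T, c)" "m \<le> c"
proof -
  obtain r c where rc: "descend (v @ w) (length v) (length v) T = (r, c)"
    by fastforce
  note d = descend_correct(1)[OF assms(1) rc]
  have "r = length v + length u" using d assms(2) by simp
  moreover have "m \<le> c" using d assms(4) unfolding agrees_def by fastforce
  ultimately show ?thesis
    using that[of c] assms(3) rc by (simp add: longest_marked_def)
qed

text \<open>Only the search for the first component is charged; the second search and the insertion
  enter with cost 0. This suffices because the expensive searches all start a phrase.\<close>

lemma lzd_lb_step:
  assumes "is_longest D (u @ v @ w) u" "u \<noteq> []" "is_longest D (v @ w) v" "v \<noteq> []"
    "agrees D (u @ v @ w) m" "lzd_lb (insert (u @ v) D) w c"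
  shows "lzd_lb D (u @ v @ w) (m + c)"
  unfolding lzd_lb_def
proof (intro allI impI)
  fix x T
  let ?s = "x @ u @ v @ w"
  assume T: "wf_trie ?s T" "marked ?s T = D"
  obtain c1 where c1: "longest_marked ?s T (length x) = (length x + length u, T, c1)" "m \<le> c1"
    using longest_marked_correct[of x "u @ v @ w" T u m] assms T by blast
  obtain c2 where c2: "longest_marked ?s T (length x + length u) = (length x + length u + length v, T, c2)"
    using longest_marked_correct[of "x @ u" "v @ w" T v 0] assms T by (auto simp: agrees_def)
  obtain T3 c3 where T3: "insert_string ?s (length x) (length x + length u + length v) T = (T3, c3)"
    by fastforce
  have "slice ?s (length x) (length x + length u + length v) = u @ v" by (simp add: slice_def)
  then have wf: "wf_trie ?s T3" "marked ?s T3 = insert (u @ v) D"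
    using insert_correct(1)[OF T(1) _ _ T3] T(2) by auto
  have "c \<le> snd (lzd_loop ?s T3 (length x + length u + length v))"
    using assms(6) wf unfolding lzd_lb_def
    by (metis (no_types, lifting) add.assoc append.assoc length_append)
  then show "m + c \<le> snd (lzd_loop ?s T (length x))"
    using assms(2,4) c1 c2 T3 by (subst lzd_loop.simps) (auto split: prod.splits)
qed

lemma lzmw_lb_step:
  assumes "is_longest D (u @ w) u" "u \<noteq> []"
    "agrees D (u @ w) m" "lzmw_lb (insert (p @ u) D) u w c"
  shows "lzmw_lb D p (u @ w) (m + c)"
  unfolding lzmw_lb_def
proof (intro allI impI)
  fix x T
  let ?s = "x @ p @ u @ w"
  assume T: "wf_trie ?s T" "marked ?s T = D"
  obtain c1 where c1: "longest_marked ?s T (length (x @ p)) = (length (x @ p) + length u, T, c1)" "m \<le> c1"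
    using longest_marked_correct[of "x @ p" "u @ w" T u m] assms T by auto
  obtain T3 c3 where T3: "insert_string ?s (length x) (length (x @ p) + length u) T = (T3, c3)"
    by fastforce
  have "slice ?s (length x) (length (x @ p) + length u) = p @ u" by (simp add: slice_def)
  then have wf: "wf_trie ?s T3" "marked ?s T3 = insert (p @ u) D"
    using insert_correct(1)[OF T(1) _ _ T3] T(2) by auto
  have "c \<le> snd (lzmw_loop ?s T3 (Some (length (x @ p))) (length (x @ p) + length u))"
    using assms(4) wf unfolding lzmw_lb_def
    by (metis (no_types, lifting) append.assoc length_append)
  then show "m + c \<le> snd (lzmw_loop ?s T (Some (length x)) (length (x @ p)))"
    using assms(2) c1 T3 by (subst lzmw_loop.simps) (auto split: prod.splits)
qed

text \<open>In a binary text of this form, unseen letters occur only at the first two positions,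
  which are executed by hand.\<close>

lemma naive_lzd_time_ge:
  assumes "lzd_lb {[a], [b], [a, b]} w c" "a \<noteq> b"
  shows "c \<le> naive_lzd_time (a # b # w)"
proof -
  let ?s = "a # b # w"
  have 1: "longest_marked ?s (Node False []) 0 = (1, Node False [(0, 1, Node True [])], 0)"
    by (simp add: longest_marked_def)
  have 2: "longest_marked ?s (Node False [(0, 1, Node True [])]) 1 =
     (2, Node False [(0, 1, Node True []), (1, 2, Node True [])], 1)"
    using assms(2) by (simp add: longest_marked_def)
  let ?T = "Node False [(0, 1, Node True []), (1, 2, Node True [])]"
  have T: "wf_trie ?s ?T" "marked ?s ?T = {[a], [b]}"
    using assms(2) by (auto simp: slice_def)
  obtain T3 c3 where T3: "insert_string ?s 0 2 ?T = (T3, c3)" by fastforce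
  have wf: "wf_trie ?s T3" "marked ?s T3 = {[a], [b], [a, b]}"
    using insert_correct(1)[OF T(1) _ _ T3] T(2) by (auto simp: slice_def)
  have "c \<le> snd (lzd_loop ?s T3 2)"
    using assms(1)[unfolded lzd_lb_def, rule_format, of "[a, b]" T3] wf by (simp add: numeral_2_eq_2)
  then show ?thesis
    unfolding naive_lzd_time_def naive_lzd_def
    using 1 2 T3 by (subst lzd_loop.simps) (auto split: prod.splits)
qed

lemma naive_lzmw_time_ge:
  assumes "lzmw_lb {[a], [b], [a, b]} [b] w c" "a \<noteq> b"
  shows "c \<le> naive_lzmw_time (a # b # w)"
proof -
  let ?s = "a # b # w"
  have 1: "longest_marked ?s (Node False []) 0 = (1, Node False [(0, 1, Node True [])], 0)"
    by (simp add: longest_marked_def)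
  have 2: "longest_marked ?s (Node False [(0, 1, Node True [])]) 1 =
     (2, Node False [(0, 1, Node True []), (1, 2, Node True [])], 1)"
    using assms(2) by (simp add: longest_marked_def)
  let ?T = "Node False [(0, 1, Node True []), (1, 2, Node True [])]"
  have T: "wf_trie ?s ?T" "marked ?s ?T = {[a], [b]}"
    using assms(2) by (auto simp: slice_def)
  obtain T3 c3 where T3: "insert_string ?s 0 2 ?T = (T3, c3)" by fastforce
  have wf: "wf_trie ?s T3" "marked ?s T3 = {[a], [b], [a, b]}"
    using insert_correct(1)[OF T(1) _ _ T3] T(2) by (auto simp: slice_def)
  have "c \<le> snd (lzmw_loop ?s T3 (Some 1) 2)"
    using assms(1)[unfolded lzmw_lb_def, rule_format, of "[a]" T3] wf by (simp add: numeral_2_eq_2)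
  then have "c \<le> snd (lzmw_loop ?s (Node False [(0, 1, Node True [])]) (Some 0) 1)"
    using 2 T3 by (subst lzmw_loop.simps) (auto split: prod.splits)
  then show ?thesis
    unfolding naive_lzmw_time_def naive_lzmw_def
    using 1 by (subst lzmw_loop.simps) (auto split: prod.splits)
qed

section \<open>Coding letters in binary\<close>

definition code :: "nat \<Rightarrow> bool list" where
  "code a = replicate a False @ [True]"

definition enc :: "nat list \<Rightarrow> bool list" where
  "enc l = concat (map code l)"

lemma enc_simps [simp]: "enc [] = []" "enc (a # l) = code a @ enc l" "enc (l @ l') = enc l @ enc l'"
  by (simp_all add: enc_def)

lemma length_code [simp]: "length (code a) = a + 1"
  by (simp add: code_def)

lemma code_ne_Nil [simp]: "code a \<noteq> []"
  by (simp add: code_def)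

lemma code_0: "code 0 = [True]"
  by (simp add: code_def)

lemma code_Suc: "code (Suc a) = False # code a"
  by (simp add: code_def)

lemma code_append_eq: "code a @ x = code b @ y \<longleftrightarrow> a = b \<and> x = y"
proof (induction a arbitrary: b)
  case 0
  then show ?case by (cases b) (auto simp: code_0 code_Suc)
next
  case (Suc a)
  then show ?case by (cases b) (auto simp: code_0 code_Suc)
qed

lemma prefix_code_append: "prefix (code a @ x) (code b @ y) \<longleftrightarrow> a = b \<and> prefix x y"
  by (auto simp: prefix_def code_append_eq)

text \<open>Codes are prefix-free, so matching of encodings mirrors matching over the
  letters.\<close>

lemma prefix_enc_iff: "prefix (enc u) (enc w) \<longleftrightarrow> prefix u w"
proof (induction u arbitrary: w)
  case (Cons a u)
  then show ?case by (cases w) (auto simp: prefix_code_append)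
qed simp

lemma length_enc_ge: "\<forall>a\<in>set l. k \<le> a \<Longrightarrow> k * length l \<le> length (enc l)"
  by (induction l) auto

lemma length_enc_le: "\<forall>a\<in>set l. a < k \<Longrightarrow> length (enc l) \<le> k * length l"
  by (induction l) auto

text \<open>
  A binary dictionary that contains no string matching beyond the first letter of an encoded text,
  other than encodings, behaves on encoded texts like a dictionary over the letters.
\<close>

definition harmless :: "bool list set \<Rightarrow> bool" where
  "harmless J \<longleftrightarrow> (\<forall>w\<in>J. \<forall>l. 0 \<notin> set l \<longrightarrow> prefix w (enc l) \<longrightarrow> length w \<le> 1)"

text \<open>A matching \<open>enc x\<close> stems from a prefix \<open>x\<close> of \<open>w\<close>
  no longer than \<open>u\<close>, hence from a prefix of \<open>u\<close>. A matching harmless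
  entry has at most one bit, and \<open>enc u\<close> has at least one.\<close>

lemma is_longest_enc:
  assumes "harmless J" "is_longest D w u" "u \<noteq> []" "0 \<notin> set w"
  shows "is_longest (J \<union> enc ` D) (enc w) (enc u)"
  unfolding is_longest_def
proof (intro conjI ballI impI)
  show "enc u \<in> J \<union> enc ` D" "prefix (enc u) (enc w)"
    using assms by (auto simp: is_longest_def prefix_enc_iff)
  fix d assume d: "d \<in> J \<union> enc ` D" "prefix d (enc w)"
  show "length d \<le> length (enc u)"
  proof (cases "d \<in> J")
    case True
    then have "length d \<le> 1" using d assms by (auto simp: harmless_def)
    also have "1 \<le> length (enc u)" using assms(3) by (cases u) auto
    finally show ?thesis .
  next
    case False
    then obtain x where x: "x \<in> D" "d = enc x" using d by auto
    then have "prefix x w" "length x \<le> length u"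
      using d assms by (auto simp: prefix_enc_iff is_longest_def)
    then have "prefix x u" using assms(2) prefix_length_prefix by (auto simp: is_longest_def)
    then show ?thesis using x prefix_length_le prefix_enc_iff by blast
  qed
qed

lemma agrees_enc:
  assumes "d \<in> D" "prefix z d" "prefix z w" "m \<le> length (enc z)"
  shows "agrees (J \<union> enc ` D) (enc w) m"
  unfolding agrees_def using assms prefix_enc_iff by blast

section \<open>Preambles that turn all codes into entries\<close>

definition lzd_alphabet :: "nat \<Rightarrow> bool list set" where
  "lzd_alphabet r = insert [False] (code ` {..r})"

lemma lzd_alphabet_eq: "lzd_alphabet r = {[False]} \<union> enc ` (\<lambda>a. [a]) ` {..r}"
  by (simp add: lzd_alphabet_def image_image)

lemma code_eq_iff [simp]: "code a = code b \<longleftrightarrow> a = b"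
  using code_append_eq[of a "[]" b "[]"] by simp

lemma prefix_code [simp]: "prefix (code a) (code b @ y) \<longleftrightarrow> a = b"
  using prefix_code_append[of a "[]" b y] by simp

text \<open>\<open>code (Suc k)\<close> is \<open>False\<close> followed by \<open>code k\<close>.
  Once the codes up to \<open>k\<close> are known, it is read as exactly these two components and
  thereby becomes an entry.\<close>

lemma lzd_lb_alphabet:
  assumes "lzd_lb (lzd_alphabet r) w c" "k \<le> r"
  shows "lzd_lb (lzd_alphabet k) (enc [Suc k..<Suc r] @ w) c"
  using assms(2,1)
proof (induction k rule: inc_induct)
  case (step k)
  let ?w = "enc [Suc (Suc k)..<Suc r] @ w"
  have "\<not> prefix (code a) (False # code k @ ?w)" if "a \<le> k" for a
    using prefix_code[of a "Suc k" ?w] that by (simp add: code_Suc)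
  then have 1: "is_longest (lzd_alphabet k) ([False] @ code k @ ?w) [False]"
    by (auto simp: is_longest_def lzd_alphabet_def)
  have 2: "is_longest (lzd_alphabet k) (code k @ ?w) (code k)"
    by (auto simp: is_longest_def lzd_alphabet_def)
  have "insert ([False] @ code k) (lzd_alphabet k) = lzd_alphabet (Suc k)"
    by (auto simp: lzd_alphabet_def atMost_Suc code_Suc)
  then have "lzd_lb (insert ([False] @ code k) (lzd_alphabet k)) ?w c"
    using step by simp
  then have "lzd_lb (lzd_alphabet k) ([False] @ code k @ ?w) (0 + c)"
    by (intro lzd_lb_step 1 2) (auto simp: agrees_def)
  moreover have "enc [Suc k..<Suc r] @ w = [False] @ code k @ ?w"
    using step by (subst upt_conv_Cons) (auto simp: code_Suc)
  ultimately show ?case by simp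
qed simp

lemma naive_lzd_time_enc_ge:
  assumes "lzd_lb (lzd_alphabet r) w c" "0 < r"
  shows "c \<le> naive_lzd_time (enc [1..<Suc r] @ w)"
proof -
  have "lzd_alphabet 1 = {[False], [True], [False, True]}"
    by (auto simp: lzd_alphabet_def atMost_Suc code_def)
  then have "lzd_lb {[False], [True], [False, True]} (enc [Suc 1..<Suc r] @ w) c"
    using lzd_lb_alphabet[OF assms(1), of 1] assms(2) by simp
  moreover have "enc [1..<Suc r] @ w = False # True # enc [Suc 1..<Suc r] @ w"
    using assms(2) by (subst upt_conv_Cons) (auto simp: code_def)
  ultimately show ?thesis by (simp add: naive_lzd_time_ge)
qed

text \<open>Joins that the LZMW preamble produces on the way: \<open>code j\<close> with
  \<open>True # replicate j False\<close>, and the latter with \<open>False\<close>.\<close>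

definition lzmw_junk :: "nat \<Rightarrow> bool list set" where
  "lzmw_junk r = insert [False] ((\<lambda>j. True # replicate j False) ` {..r} \<union>
     (\<lambda>j. code j @ True # replicate j False) ` {..<r})"

definition lzmw_alphabet :: "nat \<Rightarrow> bool list set" where
  "lzmw_alphabet r = lzmw_junk r \<union> code ` {..Suc r}"

lemma lzmw_alphabet_eq: "lzmw_alphabet r = lzmw_junk r \<union> enc ` (\<lambda>a. [a]) ` {..Suc r}"
  by (simp add: lzmw_alphabet_def image_image)

text \<open>A block is parsed as \<open>True # replicate r False\<close>, \<open>[False]\<close>,
  \<open>code (Suc r)\<close>. The last two phrases join to the next code, the first two to the
  entry with which the next block starts.\<close>

fun lzmw_preamble :: "nat \<Rightarrow> bool list" where
  "lzmw_preamble 0 = []"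
| "lzmw_preamble (Suc r) = lzmw_preamble r @ True # replicate r False @ False # code (Suc r)"

lemma harmless_lzd: "harmless {[False]}"
  by (auto simp: harmless_def)

text \<open>Without the letter 0 every code begins with \<open>False\<close>. So an encoded text has
  no \<open>True\<close> at its start or right after a complete code, where each of these entries
  except \<open>[False]\<close> has one.\<close>

lemma harmless_lzmw: "harmless (lzmw_junk r)"
proof -
  have T: "\<not> prefix (True # x) (enc l)" if "0 \<notin> set l" for l x
  proof (cases l)
    case (Cons a l')
    then show ?thesis using that by (cases a) (auto simp: code_Suc)
  qed simp
  have "\<not> prefix (code j @ True # x) (enc l)" if "0 \<notin> set l" for l x j
  proof (cases l)
    case (Cons a l')
    then show ?thesis using that T[of l' x] by (auto simp: prefix_code_append)
  qed simp
  then show ?thesis using T by (auto simp: harmless_def lzmw_junk_def)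
qed

lemma lzmw_lb_alphabet_step:
  assumes "lzmw_lb (lzmw_alphabet (Suc r)) (code (Suc r)) w c"
  shows "lzmw_lb (lzmw_alphabet r) (code r) (True # replicate r False @ False # code (Suc r) @ w) c"
proof -
  let ?a = "True # replicate r False"
  let ?D = "lzmw_alphabet r"
  let ?D1 = "insert (code r @ ?a) ?D"
  let ?D2 = "insert (?a @ [False]) ?D1"
  have TF: "?a @ [False] @ x = True # False # replicate r False @ x" for x
    using replicate_append_same[of r False] by (metis append_Cons append_assoc append_Nil)
  have c1: "\<not> prefix (code j @ True # x) (True # False # y)" for j x y
    using prefix_code_append[of j "True # x" 0 "False # y"] by (simp add: code_0)
  have c1': "length (code j) \<le> Suc r" if "prefix (code j) (True # y)" for j y
    using that prefix_code[of j 0 y] by (simp add: code_0)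
  have T: "\<not> prefix (True # x) (code (Suc j) @ y)" for j x y
    by (simp add: code_Suc)
  have c2: "\<not> prefix (code j @ True # x) (code k @ y)" if "j < k" for j x k y
    using that by (simp add: prefix_code_append)
  have "?a \<in> ?D" by (auto simp: lzmw_alphabet_def lzmw_junk_def)
  moreover have "length d \<le> length ?a"
    if "d \<in> ?D" "prefix d (True # False # replicate r False @ code (Suc r) @ w)" for d
    using that c1 c1' by (auto simp: lzmw_alphabet_def lzmw_junk_def)
  ultimately have 1: "is_longest ?D (?a @ [False] @ code (Suc r) @ w) ?a"
    unfolding is_longest_def TF[symmetric] by (blast intro: prefixI)
  have "is_longest ?D1 (code (Suc (Suc r)) @ w) [False]"
    using T c2 unfolding is_longest_def
    by (auto simp: lzmw_alphabet_def lzmw_junk_def) (simp add: code_Suc)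
  then have 2: "is_longest ?D1 ([False] @ code (Suc r) @ w) [False]"
    by (simp add: code_Suc)
  have 3: "is_longest ?D2 (code (Suc r) @ w) (code (Suc r))"
    using T c2 unfolding is_longest_def
    by (auto simp: lzmw_alphabet_def lzmw_junk_def)
  have "?a @ [False] = True # replicate (Suc r) False"
    by (simp add: replicate_append_same)
  then have "insert ([False] @ code (Suc r)) ?D2 = lzmw_alphabet (Suc r)"
    by (auto simp: lzmw_alphabet_def lzmw_junk_def atMost_Suc lessThan_Suc code_Suc)
  then have "lzmw_lb (insert ([False] @ code (Suc r)) ?D2) (code (Suc r)) w c" using assms by simp
  \<comment> \<open>The three phrases are prepended from the last to the first, with all searches
    charged 0.\<close>
  note this[THEN lzmw_lb_step[OF 3, of 0, rotated 2]]
  then have "lzmw_lb ?D2 [False] (code (Suc r) @ w) c" by (simp add: agrees_def)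
  note this[THEN lzmw_lb_step[OF 2, of 0, rotated 2]]
  then have "lzmw_lb ?D1 ?a ([False] @ code (Suc r) @ w) c" by (simp add: agrees_def)
  note this[THEN lzmw_lb_step[OF 1, of 0, rotated 2]]
  then have "lzmw_lb ?D (code r) (?a @ [False] @ code (Suc r) @ w) c" by (simp add: agrees_def)
  then show ?thesis by simp
qed

lemma lzmw_lb_preamble:
  "lzmw_lb (lzmw_alphabet r) (code r) w c \<Longrightarrow> lzmw_lb (lzmw_alphabet 0) (code 0) (lzmw_preamble r @ w) c"
proof (induction r arbitrary: w)
  case (Suc r)
  then show ?case using lzmw_lb_alphabet_step[OF Suc.prems] by simp
qed simp

lemma naive_lzmw_time_enc_ge:
  assumes "lzmw_lb (lzmw_alphabet r) (code r) w c"
  shows "c \<le> naive_lzmw_time (False # True # lzmw_preamble r @ w)"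
proof -
  have "lzmw_alphabet 0 = {[False], [True], [False, True]}"
    by (auto simp: lzmw_alphabet_def lzmw_junk_def atMost_Suc code_def)
  then show ?thesis
    using lzmw_lb_preamble[OF assms] by (simp add: naive_lzmw_time_ge code_0)
qed

section \<open>Segments and separators\<close>

text \<open>
  Segments consist of letters below \<open>\<sigma>\<close> and are separated by pairs of letters that are used only
  once. Of the dictionary \<open>D\<close> only a set \<open>C\<close> of entries is controlled: all others are letters or contain
  a separator below \<open>s\<close>, which does not occur in the text any more.
\<close>

fun sep_text :: "nat \<Rightarrow> nat list list \<Rightarrow> nat list" where
  "sep_text s [] = []"
| "sep_text s (w # ws) = w @ s # Suc s # sep_text (s + 2) ws"

definition letters_ok :: "nat \<Rightarrow> nat list list \<Rightarrow> bool" where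
  "letters_ok \<sigma> ws \<longleftrightarrow> (\<forall>w\<in>set ws. \<forall>a\<in>set w. 0 < a \<and> a < \<sigma>)"

definition dict_inv :: "nat \<Rightarrow> nat \<Rightarrow> nat \<Rightarrow> nat list set \<Rightarrow> nat list set \<Rightarrow> bool" where
  "dict_inv \<sigma> r s C D \<longleftrightarrow> C \<subseteq> D \<and> (\<forall>a\<le>r. [a] \<in> D) \<and> (\<forall>d\<in>C. \<forall>a\<in>set d. a < \<sigma>) \<and>
     (\<forall>d\<in>D. d \<in> C \<or> length d \<le> 1 \<or> (\<exists>a\<in>set d. \<sigma> \<le> a \<and> a < s))"

text \<open>The counterpart of \<open>is_longest\<close> for controlled entries; single letters
  count as entries because \<open>dict_inv\<close> has all letters up to \<open>r\<close> in the
  dictionary.\<close>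

definition best_match :: "nat list set \<Rightarrow> nat list \<Rightarrow> nat list \<Rightarrow> bool" where
  "best_match C w u \<longleftrightarrow> u \<noteq> [] \<and> prefix u w \<and> (u \<in> C \<or> length u = 1) \<and>
     (\<forall>d\<in>C. prefix d w \<longrightarrow> length d \<le> length u)"

definition match_cost :: "nat list set \<Rightarrow> nat list \<Rightarrow> nat \<Rightarrow> bool" where
  "match_cost C w m \<longleftrightarrow> m = 0 \<or> (\<exists>d\<in>C. \<exists>z. prefix z d \<and> prefix z w \<and> m \<le> length (enc z))"

lemma letters_ok_Cons [simp]:
  "letters_ok \<sigma> (w # ws) \<longleftrightarrow> (\<forall>a\<in>set w. 0 < a \<and> a < \<sigma>) \<and> letters_ok \<sigma> ws"
  by (simp add: letters_ok_def)

lemma letters_ok_append [simp]: "letters_ok \<sigma> (ws @ ws') \<longleftrightarrow> letters_ok \<sigma> ws \<and> letters_ok \<sigma> ws'"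
  by (auto simp: letters_ok_def)

lemma letters_ok_map: "letters_ok \<sigma> (map f xs) \<longleftrightarrow> (\<forall>x\<in>set xs. \<forall>a\<in>set (f x). 0 < a \<and> a < \<sigma>)"
  by (simp add: letters_ok_def)

lemma set_sep_text:
  assumes "letters_ok \<sigma> ws" "0 < s" "a \<in> set (sep_text s ws)"
  shows "0 < a \<and> (a < \<sigma> \<or> s \<le> a)"
  using assms by (induction s ws rule: sep_text.induct) fastforce+

section \<open>Longest matches inside segments and at separators\<close>

lemma dict_inv_insert:
  "dict_inv \<sigma> r s C D \<Longrightarrow> \<forall>a\<in>set d. a < \<sigma> \<Longrightarrow> dict_inv \<sigma> r s (insert d C) (insert d D)"
  by (auto simp: dict_inv_def)

lemma dict_inv_insert_used:
  "dict_inv \<sigma> r s C D \<Longrightarrow> s \<le> s' \<Longrightarrow> \<exists>a\<in>set d. \<sigma> \<le> a \<and> a < s' \<Longrightarrow> dict_inv \<sigma> r s' C (insert d D)"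
  unfolding dict_inv_def by (auto; meson less_le_trans)

text \<open>An uncontrolled entry of more than one letter contains a used separator, which the
  unread text lacks. A controlled entry contains no separator, so if it matches, it ends within the
  segment.\<close>

lemma best_match_is_longest:
  assumes D: "dict_inv \<sigma> r s C D" and u: "best_match C w u"
    and w: "\<forall>a\<in>set w. a < \<sigma>" and y: "\<forall>a\<in>set y. a < \<sigma> \<or> s \<le> a"
    and s: "\<sigma> \<le> s" "s \<le> r"
  shows "is_longest D (w @ s # y) u"
  unfolding is_longest_def
proof (intro conjI ballI impI)
  show "prefix u (w @ s # y)" using u by (auto simp: best_match_def)
  show "u \<in> D"
  proof (cases "u \<in> C")
    case True
    then show ?thesis using D by (auto simp: dict_inv_def)
  next
    case False
    then obtain a where a: "u = [a]" using u by (auto simp: best_match_def length_Suc_conv)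
    then have "a \<in> set w" using u by (auto simp: best_match_def prefix_def)
    then have "a \<le> r" using w s by fastforce
    then show ?thesis using D a by (simp add: dict_inv_def)
  qed
  fix d assume d: "d \<in> D" "prefix d (w @ s # y)"
  then have sub: "set d \<subseteq> set (w @ s # y)" using set_mono_prefix by blast
  have "\<not> (\<exists>a\<in>set d. \<sigma> \<le> a \<and> a < s)"
    using sub w y by fastforce
  then consider "d \<in> C" | "length d \<le> 1" using D d by (auto simp: dict_inv_def)
  then show "length d \<le> length u"
  proof cases
    case 1
    then have "s \<notin> set d" using D s by (fastforce simp: dict_inv_def)
    then have "prefix d w" using d(2) by (auto simp: prefix_append prefix_Cons)
    then show ?thesis using u 1 by (simp add: best_match_def)
  next
    case 2
    then show ?thesis using u by (cases u) (auto simp: best_match_def)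
  qed
qed

lemma separator_is_longest:
  assumes "dict_inv \<sigma> r s C D" "\<forall>a\<in>set y. a < \<sigma> \<or> s \<le> a" "\<sigma> \<le> s" "s \<le> r"
  shows "is_longest D (s # y) [s]"
  unfolding is_longest_def
proof (intro conjI ballI impI)
  show "[s] \<in> D" "prefix [s] (s # y)" using assms by (auto simp: dict_inv_def)
  fix d assume d: "d \<in> D" "prefix d (s # y)"
  then have sub: "set d \<subseteq> set (s # y)" using set_mono_prefix by blast
  have "\<not> (\<exists>a\<in>set d. \<sigma> \<le> a \<and> a < s)"
    using sub assms by fastforce
  then consider "d \<in> C" | "length d \<le> 1" using assms d by (auto simp: dict_inv_def)
  then show "length d \<le> length [s]"
  proof cases
    case 1
    then have "s \<notin> set d" using assms(1,3) by (fastforce simp: dict_inv_def)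
    then show ?thesis using d(2) by (cases d) auto
  qed auto
qed

lemma match_cost_agrees:
  assumes "match_cost C w m" "dict_inv \<sigma> r s C D"
  shows "agrees (J \<union> enc ` D) (enc (w @ y)) m"
proof (cases "m = 0")
  case False
  then obtain d z where "d \<in> C" "prefix z d" "prefix z w" "m \<le> length (enc z)"
    using assms(1) by (auto simp: match_cost_def)
  then show ?thesis
    using assms(2) by (intro agrees_enc[of d D z]) (auto simp: dict_inv_def)
qed (simp add: agrees_def)

text \<open>Quantifying over \<open>s\<close> and \<open>D\<close> makes the bound depend on the
  controlled set and the segments alone. The separators to come run from \<open>s\<close> to
  \<open>s + 2 * length ws - 1\<close>; the inequality keeps them among the letters up to
  \<open>r\<close>.\<close>

definition lzd_cost :: "nat \<Rightarrow> nat \<Rightarrow> nat list set \<Rightarrow> nat list list \<Rightarrow> nat \<Rightarrow> bool" where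
  "lzd_cost \<sigma> r C ws c \<longleftrightarrow> (\<forall>s D. 0 < \<sigma> \<longrightarrow> \<sigma> \<le> s \<longrightarrow> s + 2 * length ws \<le> Suc r \<longrightarrow> letters_ok \<sigma> ws \<longrightarrow>
     dict_inv \<sigma> r s C D \<longrightarrow> lzd_lb ({[False]} \<union> enc ` D) (enc (sep_text s ws)) c)"

lemma lzd_cost_Nil: "lzd_cost \<sigma> r C [] 0"
  by (simp add: lzd_cost_def lzd_lb_0)

lemma lzd_lb_enc_step:
  assumes "is_longest D (u @ v @ w) u" "u \<noteq> []" "is_longest D (v @ w) v" "v \<noteq> []" "0 \<notin> set (u @ v @ w)"
    "agrees ({[False]} \<union> enc ` D) (enc (u @ v @ w)) m"
    "lzd_lb ({[False]} \<union> enc ` insert (u @ v) D) (enc w) c"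
  shows "lzd_lb ({[False]} \<union> enc ` D) (enc (u @ v @ w)) (m + c)"
proof -
  have "enc u \<noteq> []" "enc v \<noteq> []" using assms(2,4) by (cases u; cases v; auto)+
  moreover have "is_longest ({[False]} \<union> enc ` D) (enc u @ enc v @ enc w) (enc u)"
    using is_longest_enc[OF harmless_lzd assms(1,2,5)] by simp
  moreover have "is_longest ({[False]} \<union> enc ` D) (enc v @ enc w) (enc v)"
    using is_longest_enc[OF harmless_lzd assms(3,4)] assms(5) by simp
  ultimately show ?thesis
    using lzd_lb_step[of "{[False]} \<union> enc ` D" "enc u" "enc v" "enc w" m c] assms(6,7)
    by (simp add: insert_commute)
qed

text \<open>The two separators are the two components of one phrase, which is why they come in
  pairs: the new entry is uncontrolled and the next segment starts a new phrase.\<close>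

lemma lzd_cost_sep:
  assumes "lzd_cost \<sigma> r C ws c"
  shows "lzd_cost \<sigma> r C ([] # ws) c"
  unfolding lzd_cost_def
proof (intro allI impI)
  fix s D
  assume *: "0 < \<sigma>" "\<sigma> \<le> s" "s + 2 * length ([] # ws) \<le> Suc r" "letters_ok \<sigma> ([] # ws)" "dict_inv \<sigma> r s C D"
  let ?y = "sep_text (s + 2) ws"
  let ?J = "{[False]}"
  have y: "0 < a \<and> (a < \<sigma> \<or> s + 2 \<le> a)" if "a \<in> set ?y" for a
    using set_sep_text[of \<sigma> ws "s + 2" a] that * by auto
  have 1: "is_longest D ([s] @ Suc s # ?y) [s]"
    using separator_is_longest[OF *(5), of "Suc s # ?y"] y * by fastforce
  have "dict_inv \<sigma> r (Suc s) C D" using *(5) by (fastforce simp: dict_inv_def)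
  then have 2: "is_longest D ([Suc s] @ ?y) [Suc s]"
    using separator_is_longest[of \<sigma> r "Suc s" C D ?y] y * by fastforce
  have "dict_inv \<sigma> r (s + 2) C (insert ([s] @ [Suc s]) D)"
    using dict_inv_insert_used[OF *(5)] * by auto
  then have "lzd_lb (?J \<union> enc ` insert ([s] @ [Suc s]) D) (enc ?y) c"
    using * by (intro assms[unfolded lzd_cost_def, rule_format]) auto
  then have "lzd_lb (?J \<union> enc ` D) (enc ([s] @ [Suc s] @ ?y)) (0 + c)"
    using 1 2 y * by (intro lzd_lb_enc_step) (auto simp: agrees_def)
  then show "lzd_lb (?J \<union> enc ` D) (enc (sep_text s ([] # ws))) c" by simp
qed

lemma lzd_cost_phrase:
  assumes "best_match C (u @ v @ w) u" "best_match C (v @ w) v" "match_cost C (u @ v @ w) m"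
    "lzd_cost \<sigma> r (insert (u @ v) C) (w # ws) c"
  shows "lzd_cost \<sigma> r C ((u @ v @ w) # ws) (m + c)"
  unfolding lzd_cost_def
proof (intro allI impI)
  fix s D
  assume *: "0 < \<sigma>" "\<sigma> \<le> s" "s + 2 * length ((u @ v @ w) # ws) \<le> Suc r"
    "letters_ok \<sigma> ((u @ v @ w) # ws)" "dict_inv \<sigma> r s C D"
  let ?y = "Suc s # sep_text (s + 2) ws"
  let ?J = "{[False]}"
  have y: "0 < a \<and> (a < \<sigma> \<or> s \<le> a)" if "a \<in> set ?y" for a
    using set_sep_text[of \<sigma> ws "s + 2" a] that * by auto
  have 1: "is_longest D (u @ v @ w @ s # ?y) u"
    using best_match_is_longest[OF *(5) assms(1), of ?y] y * by auto
  have 2: "is_longest D (v @ w @ s # ?y) v"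
    using best_match_is_longest[OF *(5) assms(2), of ?y] y * by auto
  have "dict_inv \<sigma> r s (insert (u @ v) C) (insert (u @ v) D)"
    using * by (intro dict_inv_insert[OF *(5)]) auto
  then have "lzd_lb (?J \<union> enc ` insert (u @ v) D) (enc (sep_text s (w # ws))) c"
    using * by (intro assms(4)[unfolded lzd_cost_def, rule_format]) auto
  moreover have "0 \<notin> set (u @ v @ w @ s # ?y)" using y * by auto
  moreover have "agrees (?J \<union> enc ` D) (enc (u @ v @ w @ s # ?y)) m"
    using match_cost_agrees[OF assms(3) *(5), of ?J "s # ?y"] by simp
  ultimately show "lzd_lb (?J \<union> enc ` D) (enc (sep_text s ((u @ v @ w) # ws))) (m + c)"
    using lzd_lb_enc_step[OF 1 _ 2, of m c] assms(1,2) by (simp add: best_match_def)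
qed

text \<open>
  The next two predicates differ in the phrase that precedes the text: a separator that is not
  used again, or a phrase \<open>p\<close> that ends inside the current segment.
\<close>

definition lzmw_cost :: "nat \<Rightarrow> nat \<Rightarrow> nat list set \<Rightarrow> nat list list \<Rightarrow> nat \<Rightarrow> bool" where
  "lzmw_cost \<sigma> r C ws c \<longleftrightarrow> (\<forall>s D p. 0 < \<sigma> \<longrightarrow> \<sigma> \<le> s \<longrightarrow> s + 2 * length ws \<le> Suc r \<longrightarrow> letters_ok \<sigma> ws \<longrightarrow>
     (\<exists>a\<in>set p. \<sigma> \<le> a \<and> a < s) \<longrightarrow> dict_inv \<sigma> r s C D \<longrightarrow>
     lzmw_lb (lzmw_junk r \<union> enc ` D) (enc p) (enc (sep_text s ws)) c)"

definition lzmw_cost_in :: "nat \<Rightarrow> nat \<Rightarrow> nat list set \<Rightarrow> nat list \<Rightarrow> nat list list \<Rightarrow> nat \<Rightarrow> bool" where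
  "lzmw_cost_in \<sigma> r C p ws c \<longleftrightarrow> (\<forall>s D. 0 < \<sigma> \<longrightarrow> \<sigma> \<le> s \<longrightarrow> s + 2 * length ws \<le> Suc r \<longrightarrow> letters_ok \<sigma> ws \<longrightarrow>
     (\<forall>a\<in>set p. a < \<sigma>) \<longrightarrow> dict_inv \<sigma> r s C D \<longrightarrow>
     lzmw_lb (lzmw_junk r \<union> enc ` D) (enc p) (enc (sep_text s ws)) c)"

lemma lzmw_cost_Nil: "lzmw_cost \<sigma> r C [] 0"
  by (simp add: lzmw_cost_def lzmw_lb_0)

lemma lzmw_lb_enc_step:
  assumes "is_longest D (u @ w) u" "u \<noteq> []" "0 \<notin> set (u @ w)"
    "agrees (lzmw_junk r \<union> enc ` D) (enc (u @ w)) m"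
    "lzmw_lb (lzmw_junk r \<union> enc ` insert (p @ u) D) (enc u) (enc w) c"
  shows "lzmw_lb (lzmw_junk r \<union> enc ` D) (enc p) (enc (u @ w)) (m + c)"
proof -
  have "enc u \<noteq> []" using assms(2) by (cases u) auto
  moreover have "is_longest (lzmw_junk r \<union> enc ` D) (enc u @ enc w) (enc u)"
    using is_longest_enc[OF harmless_lzmw assms(1-3)] by simp
  ultimately show ?thesis
    using lzmw_lb_step[of "lzmw_junk r \<union> enc ` D" "enc u" "enc w" m "enc p" c] assms(4,5) by simp
qed

text \<open>The preceding phrase is joined with \<open>s\<close>, and \<open>s\<close> with
  \<open>Suc s\<close>. Both joins contain \<open>s\<close> and so stay uncontrolled;
  \<open>Suc s\<close> is then the previous phrase that \<open>lzmw_cost\<close> asks for.\<close>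

lemma lzmw_cost_sep:
  assumes "lzmw_cost \<sigma> r C ws c"
  shows "lzmw_cost_in \<sigma> r C p ([] # ws) c"
  unfolding lzmw_cost_in_def
proof (intro allI impI)
  fix s D
  assume *: "0 < \<sigma>" "\<sigma> \<le> s" "s + 2 * length ([] # ws) \<le> Suc r" "letters_ok \<sigma> ([] # ws)"
    "\<forall>a\<in>set p. a < \<sigma>" "dict_inv \<sigma> r s C D"
  let ?y = "sep_text (s + 2) ws"
  let ?J = "lzmw_junk r"
  let ?D1 = "insert (p @ [s]) D"
  have y: "0 < a \<and> (a < \<sigma> \<or> s + 2 \<le> a)" if "a \<in> set ?y" for a
    using set_sep_text[of \<sigma> ws "s + 2" a] that * by auto
  have 1: "is_longest D ([s] @ Suc s # ?y) [s]"
    using separator_is_longest[OF *(6), of "Suc s # ?y"] y * by fastforce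
  have D1: "dict_inv \<sigma> r (Suc s) C ?D1" using dict_inv_insert_used[OF *(6)] * by auto
  then have 2: "is_longest ?D1 ([Suc s] @ ?y) [Suc s]"
    using separator_is_longest[of \<sigma> r "Suc s" C ?D1 ?y] y * by fastforce
  have "dict_inv \<sigma> r (s + 2) C (insert ([s] @ [Suc s]) ?D1)"
    using dict_inv_insert_used[OF D1] * by auto
  then have "lzmw_lb (?J \<union> enc ` insert ([s] @ [Suc s]) ?D1) (enc [Suc s]) (enc ?y) c"
    using * by (intro assms[unfolded lzmw_cost_def, rule_format]) auto
  then have "lzmw_lb (?J \<union> enc ` ?D1) (enc [s]) (enc ([Suc s] @ ?y)) (0 + c)"
    using y by (intro lzmw_lb_enc_step[OF 2]) (auto simp: agrees_def)
  then have "lzmw_lb (?J \<union> enc ` D) (enc p) (enc ([s] @ Suc s # ?y)) (0 + c)"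
    using y * by (intro lzmw_lb_enc_step[OF 1]) (auto simp: agrees_def)
  then show "lzmw_lb (?J \<union> enc ` D) (enc p) (enc (sep_text s ([] # ws))) c" by simp
qed

lemma lzmw_cost_phrase:
  assumes "best_match C (u @ w) u" "match_cost C (u @ w) m"
    "lzmw_cost_in \<sigma> r (insert (p @ u) C) u (w # ws) c"
  shows "lzmw_cost_in \<sigma> r C p ((u @ w) # ws) (m + c)"
  unfolding lzmw_cost_in_def
proof (intro allI impI)
  fix s D
  assume *: "0 < \<sigma>" "\<sigma> \<le> s" "s + 2 * length ((u @ w) # ws) \<le> Suc r"
    "letters_ok \<sigma> ((u @ w) # ws)" "\<forall>a\<in>set p. a < \<sigma>" "dict_inv \<sigma> r s C D"
  let ?y = "Suc s # sep_text (s + 2) ws"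
  have y: "0 < a \<and> (a < \<sigma> \<or> s \<le> a)" if "a \<in> set ?y" for a
    using set_sep_text[of \<sigma> ws "s + 2" a] that * by auto
  have 1: "is_longest D (u @ w @ s # ?y) u"
    using best_match_is_longest[OF *(6) assms(1), of ?y] y * by auto
  have "dict_inv \<sigma> r s (insert (p @ u) C) (insert (p @ u) D)"
    using * by (intro dict_inv_insert[OF *(6)]) auto
  then have "lzmw_lb (lzmw_junk r \<union> enc ` insert (p @ u) D) (enc u) (enc (sep_text s (w # ws))) c"
    using * by (intro assms(3)[unfolded lzmw_cost_in_def, rule_format]) auto
  moreover have "0 \<notin> set (u @ w @ s # ?y)" using y * by auto
  moreover have "agrees (lzmw_junk r \<union> enc ` D) (enc (u @ w @ s # ?y)) m"
    using match_cost_agrees[OF assms(2) *(6), of "lzmw_junk r" "s # ?y"] by simp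
  ultimately show "lzmw_lb (lzmw_junk r \<union> enc ` D) (enc p) (enc (sep_text s ((u @ w) # ws))) (m + c)"
    using lzmw_lb_enc_step[OF 1, of r m p c] assms(1) by (simp add: best_match_def)
qed

lemma lzmw_cost_first_phrase:
  assumes "best_match C (u @ w) u" "match_cost C (u @ w) m"
    "lzmw_cost_in \<sigma> r C u (w # ws) c"
  shows "lzmw_cost \<sigma> r C ((u @ w) # ws) (m + c)"
  unfolding lzmw_cost_def
proof (intro allI impI)
  fix s D p
  assume *: "0 < \<sigma>" "\<sigma> \<le> s" "s + 2 * length ((u @ w) # ws) \<le> Suc r"
    "letters_ok \<sigma> ((u @ w) # ws)" "\<exists>a\<in>set p. \<sigma> \<le> a \<and> a < s" "dict_inv \<sigma> r s C D"
  let ?y = "Suc s # sep_text (s + 2) ws"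
  have y: "0 < a \<and> (a < \<sigma> \<or> s \<le> a)" if "a \<in> set ?y" for a
    using set_sep_text[of \<sigma> ws "s + 2" a] that * by auto
  have 1: "is_longest D (u @ w @ s # ?y) u"
    using best_match_is_longest[OF *(6) assms(1), of ?y] y * by auto
  have "dict_inv \<sigma> r s C (insert (p @ u) D)"
    using *(5) by (intro dict_inv_insert_used[OF *(6)]) auto
  then have "lzmw_lb (lzmw_junk r \<union> enc ` insert (p @ u) D) (enc u) (enc (sep_text s (w # ws))) c"
    using * by (intro assms(3)[unfolded lzmw_cost_in_def, rule_format]) auto
  moreover have "0 \<notin> set (u @ w @ s # ?y)" using y * by auto
  moreover have "agrees (lzmw_junk r \<union> enc ` D) (enc (u @ w @ s # ?y)) m"
    using match_cost_agrees[OF assms(2) *(6), of "lzmw_junk r" "s # ?y"] by simp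
  ultimately show "lzmw_lb (lzmw_junk r \<union> enc ` D) (enc p) (enc (sep_text s ((u @ w) # ws))) (m + c)"
    using lzmw_lb_enc_step[OF 1, of r m p c] assms(1) by (simp add: best_match_def)
qed

lemma best_match_self: "v \<noteq> [] \<Longrightarrow> v \<in> C \<or> length v = 1 \<Longrightarrow> best_match C v v"
  by (auto simp: best_match_def prefix_length_le)

lemma lzd_cost_insert:
  assumes "best_match C (u @ v) u" "v \<noteq> []" "v \<in> C \<or> length v = 1"
    "lzd_cost \<sigma> r (insert (u @ v) C) ws c"
  shows "lzd_cost \<sigma> r C ((u @ v) # ws) c"
  using lzd_cost_phrase[of C u v "[]" 0 \<sigma> r ws c] assms best_match_self[OF assms(2,3)] lzd_cost_sep
  by (simp add: match_cost_def)

text \<open>The joins of \<open>u\<close> with the separator before it and of \<open>v\<close> with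
  the one after it are uncontrolled, which leaves \<open>u @ v\<close>.\<close>

lemma lzmw_cost_insert:
  assumes "best_match C (u @ v) u" "v \<noteq> []" "v \<in> C \<or> length v = 1"
    "lzmw_cost \<sigma> r (insert (u @ v) C) ws c"
  shows "lzmw_cost \<sigma> r C ((u @ v) # ws) c"
proof -
  have "lzmw_cost_in \<sigma> r C u ((v @ []) # ws) (0 + c)"
    using best_match_self[OF assms(2,3)]
    by (intro lzmw_cost_phrase lzmw_cost_sep assms) (simp_all add: match_cost_def)
  then show ?thesis
    using lzmw_cost_first_phrase[OF assms(1), of 0] by (simp add: match_cost_def)
qed

section \<open>The hard texts\<close>

text \<open>
  In terms of the description above, \<open>e\<^sub>k\<close> is \<open>K + 2k\<close>, \<open>y\<^sub>k\<close> is \<open>K + 2k - 1\<close>, \<open>x\<^sub>m\<close> is \<open>4K + m\<close>,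
  \<open>h\<^sub>m\<close> is \<open>6K + m\<close>, and the terminator is \<open>8K\<close>. All these letters are at least \<open>K\<close>, which makes
  their codes long.
\<close>

locale hard_text =
  fixes K :: nat
  assumes K_pos: "0 < K"
begin

definition tail :: "nat \<Rightarrow> nat list" where
  "tail k = [K + 2 * k..<Suc (3 * K)]"

abbreviation body :: "nat list" where
  "body \<equiv> tail 0"

fun core :: "nat \<Rightarrow> nat list" where
  "core 0 = []"
| "core (Suc m) = (4 * K + m) # body @ (6 * K + m) # core m"

definition long :: "nat \<Rightarrow> nat list" where
  "long m = core m @ [8 * K]"

lemma length_tail: "length (tail k) = 2 * K + 1 - 2 * k"
  by (simp add: tail_def del: upt_Suc)

lemma tail_eq_Cons: "k \<le> K \<Longrightarrow> \<exists>t. tail k = (K + 2 * k) # t"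
  by (simp add: tail_def upt_conv_Cons del: upt_Suc)

lemma tail_Suc: "k < K \<Longrightarrow> tail k = [K + 2 * k, K + 2 * k + 1] @ tail (Suc k)"
  by (simp add: tail_def upt_conv_Cons del: upt_Suc)

lemma tail_ne_Nil [simp]: "k \<le> K \<Longrightarrow> tail k \<noteq> []"
  using tail_eq_Cons by fastforce

lemma hd_tail_alone [simp]: "k \<le> K \<Longrightarrow> hd (tail k) = K + 2 * k"
  using tail_eq_Cons[of k] by auto

lemma hd_tail: "k \<le> K \<Longrightarrow> hd (tail k @ x) = K + 2 * k"
  using tail_eq_Cons[of k] by auto

lemma take_body_Suc: "l \<le> 2 * K \<Longrightarrow> take (Suc l) body = take l body @ [K + l]"
  by (simp add: tail_def del: upt_Suc) simp

lemma body_split: "j < K \<Longrightarrow> body = take (2 * j + 1) body @ (K + 2 * j + 1) # tail (Suc j)"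
proof -
  assume j: "j < K"
  have "drop (2 * j + 1) body = [K + 2 * j + 1..<Suc (3 * K)]"
    by (simp add: tail_def del: upt_Suc)
  also have "\<dots> = (K + 2 * j + 1) # tail (Suc j)"
    using j by (subst upt_conv_Cons) (auto simp: tail_def simp del: upt_Suc)
  finally have "drop (2 * j + 1) body = (K + 2 * j + 1) # tail (Suc j)" .
  then show ?thesis by (metis append_take_drop_id)
qed

lemma length_core: "length (core m) = m * (2 * K + 3)"
  by (induction m) (auto simp: length_tail)

lemma set_core: "m \<le> K \<Longrightarrow> a \<in> set (core m) \<Longrightarrow> K \<le> a \<and> a < 7 * K"
  by (induction m) (auto simp: tail_def)

definition tails :: "nat \<Rightarrow> nat list set" where
  "tails k = (\<lambda>i. [K + 2 * i, K + 2 * i + 1]) ` {k..<K} \<union> tail ` {k..<K}"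

definition longs :: "nat \<Rightarrow> nat list set" where
  "longs n = tails 0 \<union> (\<lambda>m. body @ [6 * K + m]) ` {..<n} \<union>
     (\<lambda>m. body @ (6 * K + m) # long m) ` {..<n} \<union> (\<lambda>m. long (Suc m)) ` {..<n}"

fun tail_segments :: "nat \<Rightarrow> nat list list" where
  "tail_segments 0 = []"
| "tail_segments (Suc i) = [K + 2 * i, K + 2 * i + 1] # tail i # tail_segments i"

definition long_segments :: "nat \<Rightarrow> nat list list" where
  "long_segments n = concat (map (\<lambda>m. [body @ [6 * K + m], body @ (6 * K + m) # long m, long (Suc m)]) [n..<K])"

text \<open>All that the preparation of the dictionary uses of either algorithm: a segment that
  splits into two matches makes exactly their join a controlled entry. The preparation is thus
  treated once for both.\<close>

definition insertable :: "(nat list set \<Rightarrow> nat list list \<Rightarrow> nat \<Rightarrow> bool) \<Rightarrow> bool" where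
  "insertable G \<longleftrightarrow> (\<forall>C u v ws c. best_match C (u @ v) u \<longrightarrow> v \<noteq> [] \<longrightarrow> v \<in> C \<or> length v = 1 \<longrightarrow>
     G (insert (u @ v) C) ws c \<longrightarrow> G C ((u @ v) # ws) c)"

lemma insertableD:
  "insertable G \<Longrightarrow> best_match C (u @ v) u \<Longrightarrow> v \<noteq> [] \<Longrightarrow> v \<in> C \<or> length v = 1 \<Longrightarrow>
     G (insert (u @ v) C) ws c \<Longrightarrow> G C ((u @ v) # ws) c"
  unfolding insertable_def by blast

lemma best_matchI:
  assumes "u \<noteq> []" "prefix u w" "u \<in> C \<or> length u = 1"
    "\<And>d. d \<in> C \<Longrightarrow> prefix d w \<Longrightarrow> hd d = hd w \<Longrightarrow> d \<noteq> [] \<Longrightarrow> length d \<le> length u"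
  shows "best_match C w u"
  unfolding best_match_def
proof (intro conjI ballI impI)
  fix d assume d: "d \<in> C" "prefix d w"
  show "length d \<le> length u"
  proof (cases "d = []")
    case False
    then have "hd d = hd w" using d(2) by (cases d; cases w) auto
    then show ?thesis using assms(4) d False by blast
  qed simp
qed (use assms in auto)

text \<open>Entries arise only by joining two entries or letters, so \<open>tail i\<close> takes two
  segments: the pair of its leading letters, then this pair joined with
  \<open>tail (Suc i)\<close>.\<close>

lemma tails_cost:
  assumes "insertable G" "G (tails 0) ws c" "k \<le> K"
  shows "G (tails k) (tail_segments k @ ws) c"
  using assms(3)
proof (induction k)
  case (Suc i)
  let ?p = "[K + 2 * i, K + 2 * i + 1]"
  have i: "i < K" using Suc by simp
  have hd: "d = [] \<or> hd d > K + 2 * i" if "d \<in> tails (Suc i)" for d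
    using that hd_tail[of _ "[]"] by (auto simp: tails_def)
  have ins: "insert (?p @ tail (Suc i)) (insert ([K + 2 * i] @ [K + 2 * i + 1]) (tails (Suc i))) = tails i"
  proof -
    have "{i..<K} = insert i {Suc i..<K}" using i by auto
    then show ?thesis using tail_Suc[OF i] by (auto simp: tails_def)
  qed
  \<comment> \<open>\<open>tail K\<close> is a single letter and therefore not listed in
    \<open>tails\<close>.\<close>
  have "tail (Suc i) \<in> tails (Suc i) \<or> length (tail (Suc i)) = 1"
  proof (cases "Suc i = K")
    case False
    then show ?thesis using i by (auto simp: tails_def)
  qed (simp add: length_tail)
  moreover have "best_match (insert ?p (tails (Suc i))) (?p @ tail (Suc i)) ?p"
    using hd by (intro best_matchI) force+
  moreover have "G (tails i) (tail_segments i @ ws) c" using Suc by simp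
  ultimately have "G (insert ?p (tails (Suc i))) ((?p @ tail (Suc i)) # tail_segments i @ ws) c"
    using i ins by (intro insertableD[OF assms(1)]) auto
  moreover have "best_match (tails (Suc i)) ([K + 2 * i] @ [K + 2 * i + 1]) [K + 2 * i]"
    using hd by (intro best_matchI) force+
  ultimately have "G (tails (Suc i)) (([K + 2 * i] @ [K + 2 * i + 1]) # (?p @ tail (Suc i)) # tail_segments i @ ws) c"
    by (intro insertableD[OF assms(1), of "tails (Suc i)"]) auto
  then show ?case using tail_Suc[OF i] by simp
qed (use assms in simp)

lemma longs_cases:
  assumes "d \<in> longs n" "n \<le> K"
  obtains (pair) i where "i < K" "d = [K + 2 * i, K + 2 * i + 1]"
  | (tail) i where "i < K" "d = tail i"
  | (body) m z where "m < n" "d = body @ (6 * K + m) # z"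
  | (long) m where "m < n" "d = long (Suc m)"
  using assms unfolding longs_def tails_def by auto

text \<open>\<open>long (Suc m)\<close> is built from \<open>long m\<close> in three joins. The
  first one, \<open>body @ [6 * K + m]\<close>, makes the parse of the second segment break right
  before \<open>long m\<close>; the last one prepends \<open>4 * K + m\<close>.\<close>

lemma longs_cost:
  assumes "insertable G" "G (longs K) ws c" "n \<le> K"
  shows "G (longs n) (long_segments n @ ws) c"
  using assms(3)
proof (induction n rule: inc_induct)
  case (step m)
  let ?b = "body @ [6 * K + m]" and ?r = "body @ (6 * K + m) # long m"
  let ?C1 = "insert ?b (longs m)"
  let ?C2 = "insert ?r ?C1"
  have mK: "m < K" using step by simp
  have lm: "long m \<in> longs m \<or> length (long m) = 1"
    by (cases m) (auto simp: longs_def long_def)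
  have 1: "best_match (longs m) (body @ [6 * K + m]) body"
  proof (rule best_matchI)
    show "body \<in> longs m \<or> length body = 1" using K_pos by (auto simp: longs_def tails_def)
    fix d assume d: "d \<in> longs m" "prefix d (body @ [6 * K + m])" "hd d = hd (body @ [6 * K + m])"
    then have hd: "hd d = K" by (simp add: hd_tail)
    show "length d \<le> length body"
      using d(1) mK[THEN less_imp_le]
    proof (cases rule: longs_cases)
      \<comment> \<open>Here \<open>m' < m\<close>, so such an entry fails at the letter after
        \<open>body\<close>.\<close>
      case (body m' z)
      then show ?thesis using d(2) by auto
    next
      case (tail i)
      then show ?thesis by (simp add: length_tail)
    qed (use hd K_pos in \<open>auto simp: long_def length_tail\<close>)
  qed auto
  have 2: "best_match ?C1 (?b @ long m) ?b"
  proof (rule best_matchI)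
    fix d assume d: "d \<in> ?C1" "prefix d (?b @ long m)" "hd d = hd (?b @ long m)"
    then have hd: "hd d = K" by (simp add: hd_tail)
    show "length d \<le> length ?b"
    proof (cases "d = ?b")
      case False
      then have "d \<in> longs m" using d by simp
      then show ?thesis using mK[THEN less_imp_le]
      proof (cases rule: longs_cases)
        case (body m' z)
        then show ?thesis using d(2) by auto
      next
        case (tail i)
        then show ?thesis by (simp add: length_tail)
      qed (use hd K_pos in \<open>auto simp: long_def length_tail\<close>)
    qed simp
  qed auto
  have 3: "best_match ?C2 ([4 * K + m] @ ?r) [4 * K + m]"
  proof (rule best_matchI)
    fix d assume d: "d \<in> ?C2" "hd d = hd ([4 * K + m] @ ?r)" 
    then have hd: "hd d = 4 * K + m" by simp
    then have "d \<in> longs m" using d hd_tail[of 0] K_pos by auto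
    then show "length d \<le> length [4 * K + m]" using mK[THEN less_imp_le]
      by (cases rule: longs_cases) (use hd K_pos mK in \<open>auto simp: long_def\<close>)
  qed auto
  have "insert ([4 * K + m] @ ?r) ?C2 = longs (Suc m)"
    by (auto simp: longs_def lessThan_Suc long_def)
  then have "G (insert ([4 * K + m] @ ?r) ?C2) (long_segments (Suc m) @ ws) c"
    using step by simp
  then have "G ?C2 (([4 * K + m] @ ?r) # long_segments (Suc m) @ ws) c"
    by (rule insertableD[OF assms(1) 3, rotated 2]) auto
  moreover have "?b @ long m = ?r" by simp
  ultimately have "G ?C1 ((?b @ long m) # ([4 * K + m] @ ?r) # long_segments (Suc m) @ ws) c"
    using lm by (intro insertableD[OF assms(1) 2]) (auto simp: long_def)
  then have "G (longs m) ((body @ [6 * K + m]) # (?b @ long m) # ([4 * K + m] @ ?r) # long_segments (Suc m) @ ws) c"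
    by (intro insertableD[OF assms(1) 1]) auto
  then show ?case using mK by (simp add: long_segments_def upt_conv_Cons long_def)
qed (simp add: long_segments_def assms)

text \<open>
  \<open>L m\<close> is the number of letters that the entries at \<open>x\<^sub>m\<close> have reached; \<open>V\<close>, \<open>W\<close> and \<open>B\<close> are sets of
  pairs (position in \<open>u\<close>, block): exits that may have been prolonged arbitrarily, exits inserted
  before a round (LZMW only), and letters \<open>y\<close> merged with the following exit (LZMW only).
\<close>

definition allowed :: "(nat \<Rightarrow> nat) \<Rightarrow> (nat \<times> nat) set \<Rightarrow> (nat \<times> nat) set \<Rightarrow> (nat \<times> nat) set \<Rightarrow> nat list set" where
  "allowed L V W B = longs K \<union> {(4 * K + m) # take l body |m l. m < K \<and> l \<le> L m} \<union>
     {tail k @ (6 * K + m) # z |k m z. k \<le> K \<and> (k, m) \<in> V} \<union>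
     {tail k @ [6 * K + m] |k m. k \<le> K \<and> (k, m) \<in> W} \<union>
     {(K + 2 * k + 1) # tail (Suc k) @ [6 * K + m] |k m. k < K \<and> (Suc k, m) \<in> B}"

text \<open>Only bounds on the controlled set are tracked: membership makes the intended phrases
  entries, \<open>allowed\<close> excludes longer matches. For \<open>L m = 0\<close> the phrase is
  a single letter, an entry without being controlled.\<close>

definition state :: "(nat \<Rightarrow> nat) \<Rightarrow> (nat \<times> nat) set \<Rightarrow> (nat \<times> nat) set \<Rightarrow> (nat \<times> nat) set \<Rightarrow> nat list set \<Rightarrow> bool" where
  "state L V W B C \<longleftrightarrow> longs K \<subseteq> C \<and> C \<subseteq> allowed L V W B \<and>
     (\<forall>m<K. 0 < L m \<longrightarrow> (4 * K + m) # take (L m) body \<in> C) \<and>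
     (\<forall>(k, m)\<in>W. tail k @ [6 * K + m] \<in> C)"

lemma state_longs: "state (\<lambda>_. 0) {} {} {} (longs K)"
  by (auto simp: state_def allowed_def)

lemma allowed_mono:
  assumes "\<And>m. L m \<le> L' m" "V \<subseteq> V'" "W \<subseteq> W'" "B \<subseteq> B'"
  shows "allowed L V W B \<subseteq> allowed L' V' W' B'"
proof -
  have "l \<le> L m \<Longrightarrow> l \<le> L' m" for l m using assms(1)[of m] by simp
  then show ?thesis using assms(2-4) unfolding allowed_def by blast
qed

lemma allowedI:
  "m < K \<Longrightarrow> l \<le> L m \<Longrightarrow> (4 * K + m) # take l body \<in> allowed L V W B"
  "k \<le> K \<Longrightarrow> (k, m) \<in> V \<Longrightarrow> tail k @ (6 * K + m) # z \<in> allowed L V W B"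
  "k \<le> K \<Longrightarrow> (k, m) \<in> W \<Longrightarrow> tail k @ [6 * K + m] \<in> allowed L V W B"
  "k < K \<Longrightarrow> (Suc k, m) \<in> B \<Longrightarrow> (K + 2 * k + 1) # tail (Suc k) @ [6 * K + m] \<in> allowed L V W B"
  unfolding allowed_def by blast+

text \<open>The one new entry has to account for all changes of \<open>L\<close> and
  \<open>W\<close>, which demand membership; \<open>V\<close> and \<open>B\<close> merely permit
  entries and may grow freely.\<close>

lemma stateI:
  assumes "state L V W B C" "\<And>m. L m \<le> L' m" "V \<subseteq> V'" "W \<subseteq> W'" "B \<subseteq> B'"
    "d \<in> allowed L' V' W' B'" "\<And>m. m < K \<Longrightarrow> 0 < L' m \<Longrightarrow> L' m \<noteq> L m \<Longrightarrow> (4 * K + m) # take (L' m) body = d"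
    "\<And>k m. (k, m) \<in> W' \<Longrightarrow> (k, m) \<notin> W \<Longrightarrow> tail k @ [6 * K + m] = d"
  shows "state L' V' W' B' (insert d C)"
proof -
  have "C \<subseteq> allowed L' V' W' B'"
    using assms(1) allowed_mono[of L L' V V' W W' B B'] assms(2-5) by (auto simp: state_def)
  moreover have "(4 * K + m) # take (L' m) body \<in> insert d C" if "m < K" "0 < L' m" for m
    using assms(1) assms(7)[OF that] that by (cases "L' m = L m") (auto simp: state_def)
  moreover have "tail k @ [6 * K + m] \<in> insert d C" if "(k, m) \<in> W'" for k m
    using assms(1) assms(8)[OF that] that by (cases "(k, m) \<in> W") (auto simp: state_def)
  ultimately show ?thesis using assms(1,6) by (auto simp: state_def)
qed

lemma state_insert_header:
  assumes "state L V W B C" "m < K"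
  shows "state (L(m := Suc (L m))) V W B (insert ((4 * K + m) # take (Suc (L m)) body) C)"
  using assms(2) by (intro stateI[OF assms(1)] allowedI) (auto split: if_splits)

lemma state_insert_visited:
  assumes "state L V W B C" "k \<le> K"
  shows "state L (insert (k, m) V) W B (insert (tail k @ (6 * K + m) # z) C)"
  using assms(2) by (intro stateI[OF assms(1)] allowedI) auto

lemma state_insert_exit:
  assumes "state L V W B C" "k \<le> K"
  shows "state L V (insert (k, m) W) B (insert (tail k @ [6 * K + m]) C)"
  using assms(2) by (intro stateI[OF assms(1)] allowedI(3)) auto

lemma state_insert_middle:
  assumes "state L V W B C" "k < K"
  shows "state L V W (insert (Suc k, m) B) (insert ((K + 2 * k + 1) # tail (Suc k) @ [6 * K + m]) C)"
  using assms(2) by (intro stateI[OF assms(1)] allowedI(4)) auto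

section \<open>Greedy choices in a given state\<close>

lemma state_cases:
  assumes "state L V W B C" "d \<in> C"
  obtains (pair) i where "i < K" "d = [K + 2 * i, K + 2 * i + 1]"
  | (tail) i where "i < K" "d = tail i"
  | (long) m where "m < K" "d = long (Suc m)"
  | (header) m l where "m < K" "l \<le> L m" "d = (4 * K + m) # take l body"
  | (visited) k m z where "k \<le> K" "k = 0 \<or> (k, m) \<in> V" "d = tail k @ (6 * K + m) # z"
  | (exit) k m where "k \<le> K" "(k, m) \<in> W" "d = tail k @ [6 * K + m]"
  | (middle) k m where "k < K" "(Suc k, m) \<in> B" "d = (K + 2 * k + 1) # tail (Suc k) @ [6 * K + m]"
proof -
  have "d \<in> allowed L V W B" using assms by (auto simp: state_def)
  then consider "d \<in> longs K" | m l where "m < K" "l \<le> L m" "d = (4 * K + m) # take l body"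
    | k m z where "k \<le> K" "(k, m) \<in> V" "d = tail k @ (6 * K + m) # z"
    | k m where "k \<le> K" "(k, m) \<in> W" "d = tail k @ [6 * K + m]"
    | k m where "k < K" "(Suc k, m) \<in> B" "d = (K + 2 * k + 1) # tail (Suc k) @ [6 * K + m]"
    unfolding allowed_def by blast
  then show thesis
  proof cases
    case 1
    then show ?thesis
      by (cases rule: longs_cases[OF _ order_refl]) (use pair tail long visited[of 0] in auto)
  qed (use header visited exit middle in blast)+
qed

text \<open>Entries starting with \<open>4 * K + m\<close> are prefixes of the header of body length
  \<open>L m\<close>, and the long entry, which by hypothesis does not match to its end.\<close>

lemma match_header:
  assumes "state L V W B C" "m < K" "\<not> prefix (long (Suc m)) ((4 * K + m) # take (L m) body @ z)"
  shows "best_match C ((4 * K + m) # take (L m) body @ z) ((4 * K + m) # take (L m) body)"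
proof (rule best_matchI)
  show "(4 * K + m) # take (L m) body \<in> C \<or> length ((4 * K + m) # take (L m) body) = 1"
    using assms by (cases "L m = 0") (auto simp: state_def)
  fix d assume d: "d \<in> C" "prefix d ((4 * K + m) # take (L m) body @ z)"
    "hd d = hd ((4 * K + m) # take (L m) body @ z)"
  then have hd: "hd d = 4 * K + m" by simp
  show "length d \<le> length ((4 * K + m) # take (L m) body)"
    using assms(1) d(1)
    by (cases rule: state_cases)
      (use hd d(2) assms(2,3) in \<open>auto simp: long_def\<close>)
qed auto

lemma match_middle:
  assumes "state L V W B C" "k < K" "(Suc k, m) \<notin> B"
  shows "best_match C ([K + 2 * k + 1] @ tail (Suc k) @ (6 * K + m) # z) [K + 2 * k + 1]"
proof (rule best_matchI)
  fix d assume d: "d \<in> C" "prefix d ([K + 2 * k + 1] @ tail (Suc k) @ (6 * K + m) # z)"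
    "hd d = hd ([K + 2 * k + 1] @ tail (Suc k) @ (6 * K + m) # z)"
  then have hd: "hd d = K + 2 * k + 1" by simp
  \<comment> \<open>Parity separates the letters \<open>K + 2 * i\<close>, with which pairs and
    tails start, from \<open>K + 2 * k + 1\<close>.\<close>
  have par: "2 * i \<noteq> Suc (2 * k)" for i by presburger
  show "length d \<le> length [K + 2 * k + 1]"
    using assms(1) d(1)
    by (cases rule: state_cases)
      (use hd d(2) assms(2,3) par in \<open>auto simp: long_def\<close>)
qed auto

text \<open>A longer entry with the same first letter continues \<open>tail k\<close> by some
  \<open>6 * K + m'\<close>, and the hypotheses exclude \<open>m' = m\<close>. The case
  \<open>k = 0\<close> is different: \<open>longs K\<close> continues \<open>body\<close> by
  \<open>6 * K + m\<close> for every \<open>m < K\<close>.\<close>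

lemma match_tail:
  assumes "state L V W B C" "0 < k" "k \<le> K" "(k, m) \<notin> V" "(k, m) \<notin> W"
  shows "best_match C (tail k @ (6 * K + m) # z) (tail k)"
proof (rule best_matchI)
  show "tail k \<in> C \<or> length (tail k) = 1"
    using assms by (cases "k = K") (auto simp: length_tail state_def longs_def tails_def)
  fix d assume d: "d \<in> C" "prefix d (tail k @ (6 * K + m) # z)"
    "hd d = hd (tail k @ (6 * K + m) # z)"
  then have hd: "hd d = K + 2 * k" using assms by (simp add: hd_tail)
  have par: "2 * k \<noteq> Suc (2 * i)" "Suc (2 * i) \<noteq> 2 * k" for i by presburger+
  show "length d \<le> length (tail k)"
    using assms(1) d(1)
  proof (cases rule: state_cases)
    case (visited k' m' z')
    then have "k' = k" using hd hd_tail[of k'] by simp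
    then show ?thesis using visited d(2) assms by auto
  next
    case (exit k' m')
    then have "k' = k" using hd hd_tail[of k'] by simp
    then show ?thesis using exit d(2) assms by auto
  qed (use hd assms par in \<open>auto simp: long_def length_tail\<close>)
qed (use assms in auto)

lemma match_exit_lzmw:
  assumes "state L V W B C" "0 < k" "k \<le> K" "(k, m) \<notin> V" "(k, m) \<in> W"
  shows "best_match C ((tail k @ [6 * K + m]) @ z) (tail k @ [6 * K + m])"
proof (rule best_matchI)
  show "tail k @ [6 * K + m] \<in> C \<or> length (tail k @ [6 * K + m]) = 1"
    using assms by (auto simp: state_def)
  fix d assume d: "d \<in> C" "prefix d ((tail k @ [6 * K + m]) @ z)"
    "hd d = hd ((tail k @ [6 * K + m]) @ z)"
  then have hd: "hd d = K + 2 * k" using assms by (simp add: hd_tail)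
  have par: "2 * k \<noteq> Suc (2 * i)" "Suc (2 * i) \<noteq> 2 * k" for i by presburger+
  show "length d \<le> length (tail k @ [6 * K + m])"
    using assms(1) d(1)
  proof (cases rule: state_cases)
    case (visited k' m' z')
    then have "k' = k" using hd hd_tail[of k'] by simp
    then show ?thesis using visited d(2) assms by auto
  next
    case (exit k' m')
    then have "k' = k" using hd hd_tail[of k'] by simp
    then show ?thesis using exit by simp
  qed (use hd assms par in \<open>auto simp: long_def length_tail\<close>)
qed (use assms in auto)

lemma match_separator:
  assumes "state L V W B C"
  shows "best_match C ([6 * K + m] @ z) [6 * K + m]"
proof (rule best_matchI)
  fix d assume d: "d \<in> C" "hd d = hd ([6 * K + m] @ z)"
  then have hd: "hd d = 6 * K + m" by simp
  show "length d \<le> length [6 * K + m]"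
    using assms(1) d(1)
    by (cases rule: state_cases)
      (use hd K_pos in \<open>auto simp: long_def\<close>)
qed auto


section \<open>Reading the core once\<close>

definition run_cost :: "nat \<Rightarrow> nat" where
  "run_cost n = (\<Sum>m<n. K * length (core (Suc m)))"

abbreviation header :: "nat \<Rightarrow> nat \<Rightarrow> nat list" where
  "header j m \<equiv> (4 * K + m) # take (2 * j + 1) body"

lemma core_split:
  "j < K \<Longrightarrow> core (Suc m) = header j m @ [K + 2 * j + 1] @ tail (Suc j) @ [6 * K + m] @ core m"
  using body_split[of j] by (metis append.assoc append_Cons append_Nil core.simps(2))

lemma header_extend: "j < K \<Longrightarrow> header j m @ [K + 2 * j + 1] = (4 * K + m) # take (Suc (2 * j + 1)) body"
  using take_body_Suc[of "2 * j + 1"] by simp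

lemma not_prefix_long: "length w \<le> length (core (Suc m)) \<Longrightarrow> \<not> prefix (long (Suc m)) w"
  using prefix_length_le[of "long (Suc m)" w] unfolding long_def length_append by fastforce

text \<open>The long entry agrees with the whole rest of the core up to its terminator, and each
  letter compared has a code of at least \<open>K\<close> bits.\<close>

lemma match_cost_core:
  assumes "state L V W B C" "m < K"
  shows "match_cost C (core (Suc m)) (K * length (core (Suc m)))"
  unfolding match_cost_def
proof (intro disjI2 bexI exI conjI)
  show "long (Suc m) \<in> C" using assms by (auto simp: state_def longs_def)
  show "prefix (core (Suc m)) (long (Suc m))" "prefix (core (Suc m)) (core (Suc m))"
    unfolding long_def by auto
  show "K * length (core (Suc m)) \<le> length (enc (core (Suc m)))"
    using set_core[of "Suc m"] assms by (intro length_enc_ge) auto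
qed

text \<open>The rest of the segment is one letter shorter than \<open>long (Suc m)\<close>, so the
  long entry is followed in vain and the header is taken.\<close>

lemma match_core:
  assumes "state L V W B C" "m < K" "j < K" "L m = 2 * j + 1"
  shows "best_match C (core (Suc m)) (header j m)"
proof -
  have c: "core (Suc m) = (4 * K + m) # take (L m) body @ [K + 2 * j + 1] @ tail (Suc j) @ [6 * K + m] @ core m"
    using core_split[OF assms(3)] assms(4) by simp
  have "\<not> prefix (long (Suc m)) (core (Suc m))" by (simp add: not_prefix_long del: core.simps)
  then show ?thesis
    using match_header[OF assms(1,2), of "[K + 2 * j + 1] @ tail (Suc j) @ [6 * K + m] @ core m"] assms(4)
    unfolding c by simp
qed

text \<open>Blocks are read by decreasing index, and \<open>n\<close> of them are left. A block
  takes two phrases: the header with its next letter, which raises \<open>L m\<close> by one, and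
  the exit with \<open>6 * K + m\<close>, which enters \<open>V\<close> only after its use. The
  assumption \<open>next\<close> stands for the rest of the text.\<close>

lemma lzd_run:
  assumes j: "j < K"
    and "next": "\<And>L V C. state L V {} {} C \<Longrightarrow> \<forall>m<K. L m = 2 * j + 2 \<Longrightarrow> \<forall>x\<in>V. fst x \<le> Suc j \<Longrightarrow>
      lzd_cost \<sigma> r C ws c"
  shows "n \<le> K \<Longrightarrow> state L V {} {} C \<Longrightarrow> \<forall>m<K. L m = (if m < n then 2 * j + 1 else 2 * j + 2) \<Longrightarrow>
    \<forall>x\<in>V. fst x \<le> Suc j \<and> (fst x = Suc j \<longrightarrow> n \<le> snd x) \<Longrightarrow>
    lzd_cost \<sigma> r C (core n # ws) (run_cost n + c)"
proof (induction n arbitrary: L V C)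
  case 0
  then have "lzd_cost \<sigma> r C ws c" by (intro "next") auto
  then show ?case by (simp add: lzd_cost_sep run_cost_def)
next
  case (Suc m)
  let ?u = "header j m" and ?v = "[K + 2 * j + 1]"
  let ?w = "tail (Suc j) @ [6 * K + m] @ core m"
  let ?C1 = "insert (?u @ ?v) C"
  let ?L1 = "L(m := Suc (L m))"
  let ?C2 = "insert (tail (Suc j) @ [6 * K + m]) ?C1"
  have m: "m < K" and Lm: "L m = 2 * j + 1" using Suc by auto
  have S1: "state ?L1 V {} {} ?C1"
    using state_insert_header[OF Suc.prems(2) m] unfolding header_extend[OF j] Lm .
  have S2: "state ?L1 (insert (Suc j, m) V) {} {} ?C2"
    using state_insert_visited[OF S1, of "Suc j" m "[]"] j by simp
  have V: "(Suc j, m) \<notin> V" using bspec[OF Suc.prems(4), of "(Suc j, m)"] by auto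
  define l where "l = K * length (core (Suc m))"
  have run: "run_cost (Suc m) = l + run_cost m" by (simp add: run_cost_def l_def del: core.simps)
  have u: "best_match C (?u @ ?v @ ?w) ?u"
    using match_core[OF Suc.prems(2) m j Lm] by (simp only: core_split[OF j])
  have v: "best_match C (?v @ ?w) ?v"
    using match_middle[OF Suc.prems(2) j, of m "core m"] by simp
  have cost: "match_cost C (?u @ ?v @ ?w) l"
    using match_cost_core[OF Suc.prems(2) m, folded l_def] by (simp only: core_split[OF j])
  have u': "best_match ?C1 ?w (tail (Suc j))"
    using match_tail[OF S1 _ _ V, of "core m"] j by simp
  have "lzd_cost \<sigma> r ?C2 (core m # ws) (run_cost m + c)"
    using Suc.prems by (intro Suc.IH[OF _ S2]) (auto simp: Lm)
  then have "lzd_cost \<sigma> r ?C1 (?w # ws) (0 + (run_cost m + c))"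
    by (rule lzd_cost_phrase[OF u' match_separator[OF S1], rotated]) (simp add: match_cost_def)
  from lzd_cost_phrase[OF u v cost this] show ?case
    by (simp only: core_split[OF j] run add_0 add.assoc)
qed

text \<open>The claim starts right behind a header, since LZMW joins straddle block borders. A block
  yields the joins of header with middle letter (\<open>L\<close>), middle letter with exit
  (\<open>B\<close>) and exit with next header (\<open>V\<close>), all tied to the block just
  read.\<close>

lemma lzmw_run_in:
  assumes j: "j < K"
    and "next": "\<And>L V B C. state L V W B C \<Longrightarrow> \<forall>m<K. L m = 2 * j + 2 \<Longrightarrow> \<forall>x\<in>V \<union> B. fst x \<le> Suc j \<Longrightarrow>
      lzmw_cost \<sigma> r C ws c"
    and W: "\<forall>m<K. (Suc j, m) \<in> W"
  shows "m < K \<Longrightarrow> state L V W B C \<Longrightarrow> \<forall>i<K. L i = (if i \<le> m then 2 * j + 1 else 2 * j + 2) \<Longrightarrow>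
    \<forall>x\<in>V \<union> B. fst x \<le> Suc j \<and> (fst x = Suc j \<longrightarrow> m < snd x) \<Longrightarrow>
    lzmw_cost_in \<sigma> r C (header j m) (([K + 2 * j + 1] @ tail (Suc j) @ [6 * K + m] @ core m) # ws) (run_cost m + c)"
proof (induction m arbitrary: L V B C)
  case 0
  let ?u = "header j 0" and ?v = "[K + 2 * j + 1]"
  let ?e = "tail (Suc j) @ [6 * K + 0]"
  let ?C1 = "insert (?u @ ?v) C"
  let ?L1 = "L(0 := Suc (L 0))"
  have Lm: "L 0 = 2 * j + 1" using 0 by auto
  have S1: "state ?L1 V W B ?C1"
    using state_insert_header[OF 0(2,1)] unfolding header_extend[OF j] Lm .
  have S2: "state ?L1 V W (insert (Suc j, 0) B) (insert (?v @ ?e) ?C1)"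
    using state_insert_middle[OF S1 j, of 0] by simp
  have V: "(Suc j, 0) \<notin> V" "(Suc j, 0) \<notin> B"
    using bspec[OF 0(4), of "(Suc j, 0)"] by auto
  have v: "best_match C (?v @ ?e @ []) ?v"
    using match_middle[OF 0(2) j V(2), of "[]"] by simp
  have e: "best_match ?C1 (?e @ []) ?e"
    using match_exit_lzmw[OF S1 _ _ V(1), of "[]"] j W 0 by simp
  \<comment> \<open>The last exit is followed by a separator, so it is not joined with a header and
    \<open>V\<close> does not grow.\<close>
  have "lzmw_cost \<sigma> r (insert (?v @ ?e) ?C1) ws c"
    using 0 by (intro "next"[OF S2]) (auto simp: Lm)
  then have "lzmw_cost_in \<sigma> r (insert (?v @ ?e) ?C1) ?e ([] # ws) c"
    by (rule lzmw_cost_sep)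
  then have "lzmw_cost_in \<sigma> r ?C1 ?v ((?e @ []) # ws) (0 + c)"
    by (rule lzmw_cost_phrase[OF e, rotated]) (simp add: match_cost_def)
  then have "lzmw_cost_in \<sigma> r C ?u ((?v @ ?e @ []) # ws) (0 + (0 + c))"
    by (rule lzmw_cost_phrase[OF v, rotated]) (simp add: match_cost_def)
  then show ?case by (simp add: run_cost_def)
next
  case (Suc m)
  let ?n = "Suc m"
  let ?u = "header j ?n" and ?v = "[K + 2 * j + 1]"
  let ?e = "tail (Suc j) @ [6 * K + ?n]"
  let ?w = "[K + 2 * j + 1] @ tail (Suc j) @ [6 * K + m] @ core m"
  let ?C1 = "insert (?u @ ?v) C"
  let ?C2 = "insert (?v @ ?e) ?C1"
  let ?C3 = "insert (?e @ header j m) ?C2"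
  let ?L1 = "L(?n := Suc (L ?n))"
  have Lm: "L ?n = 2 * j + 1" "L m = 2 * j + 1" using Suc.prems by auto
  have S1: "state ?L1 V W B ?C1"
    using state_insert_header[OF Suc.prems(2,1)] unfolding header_extend[OF j] Lm .
  have S2: "state ?L1 V W (insert (Suc j, ?n) B) ?C2"
    using state_insert_middle[OF S1 j, of ?n] by simp
  have S3: "state ?L1 (insert (Suc j, ?n) V) W (insert (Suc j, ?n) B) ?C3"
    using state_insert_visited[OF S2, of "Suc j" ?n "header j m"] j by simp
  have V: "(Suc j, ?n) \<notin> V" "(Suc j, ?n) \<notin> B"
    using bspec[OF Suc.prems(4), of "(Suc j, ?n)"] by auto
  have m: "m < K" "?L1 m = 2 * j + 1" using Suc.prems Lm by auto
  define l where "l = K * length (core (Suc m))"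
  have run: "run_cost ?n = l + run_cost m" by (simp add: run_cost_def l_def del: core.simps)
  have v: "best_match C (?v @ ?e @ core ?n) ?v"
    using match_middle[OF Suc.prems(2) j V(2), of "core ?n"] by (simp del: core.simps)
  have e: "best_match ?C1 (?e @ core ?n) ?e"
    using match_exit_lzmw[OF S1 _ _ V(1), of "core ?n"] j W Suc.prems(1) by (simp del: core.simps)
  have h: "best_match ?C2 (header j m @ ?w) (header j m)"
    using match_core[OF S2 m(1) j m(2)] by (simp only: core_split[OF j])
  have cost: "match_cost ?C2 (header j m @ ?w) l"
    using match_cost_core[OF S2 m(1), folded l_def] by (simp only: core_split[OF j])
  have "lzmw_cost_in \<sigma> r ?C3 (header j m) (?w # ws) (run_cost m + c)"
    using Suc.prems by (intro Suc.IH[OF _ S3]) (auto simp: Lm)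
  then have "lzmw_cost_in \<sigma> r ?C2 ?e ((header j m @ ?w) # ws) (l + (run_cost m + c))"
    by (rule lzmw_cost_phrase[OF h cost])
  then have "lzmw_cost_in \<sigma> r ?C2 ?e (core ?n # ws) (run_cost ?n + c)"
    by (simp only: core_split[OF j] run add.assoc)
  then have "lzmw_cost_in \<sigma> r ?C1 ?v ((?e @ core ?n) # ws) (0 + (run_cost ?n + c))"
    by (rule lzmw_cost_phrase[OF e, rotated]) (simp add: match_cost_def)
  then have "lzmw_cost_in \<sigma> r C ?u ((?v @ ?e @ core ?n) # ws) (0 + (0 + (run_cost ?n + c)))"
    by (rule lzmw_cost_phrase[OF v, rotated]) (simp add: match_cost_def)
  then show ?case by (simp del: core.simps)
qed

lemma lzmw_run:
  assumes j: "j < K"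
    and "next": "\<And>L V B C. state L V W B C \<Longrightarrow> \<forall>m<K. L m = 2 * j + 2 \<Longrightarrow> \<forall>x\<in>V \<union> B. fst x \<le> Suc j \<Longrightarrow>
      lzmw_cost \<sigma> r C ws c"
    and W: "\<forall>m<K. (Suc j, m) \<in> W"
    and S: "state L V W B C" "\<forall>m<K. L m = 2 * j + 1" "\<forall>x\<in>V \<union> B. fst x \<le> j"
  shows "lzmw_cost \<sigma> r C (core K # ws) (run_cost K + c)"
proof -
  obtain m where m: "K = Suc m" using K_pos by (cases K) auto
  have mK: "m < K" "L m = 2 * j + 1" using m S(2) by auto
  let ?w = "[K + 2 * j + 1] @ tail (Suc j) @ [6 * K + m] @ core m"
  define l where "l = K * length (core (Suc m))"
  have run: "run_cost (Suc m) = l + run_cost m" by (simp add: run_cost_def l_def del: core.simps)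
  have h: "best_match C (header j m @ ?w) (header j m)"
    using match_core[OF S(1) mK(1) j mK(2)] by (simp only: core_split[OF j])
  have cost: "match_cost C (header j m @ ?w) l"
    using match_cost_core[OF S(1) mK(1), folded l_def] by (simp only: core_split[OF j])
  have "\<forall>i<K. L i = (if i \<le> m then 2 * j + 1 else 2 * j + 2)" using S(2) m by auto
  moreover have "\<forall>x\<in>V \<union> B. fst x \<le> Suc j \<and> (fst x = Suc j \<longrightarrow> m < snd x)"
  proof
    fix x assume "x \<in> V \<union> B"
    then have "fst x \<le> j" using S(3) by blast
    then show "fst x \<le> Suc j \<and> (fst x = Suc j \<longrightarrow> m < snd x)" by simp
  qed
  ultimately have "lzmw_cost_in \<sigma> r C (header j m) (?w # ws) (run_cost m + c)"
    by (intro lzmw_run_in[OF j _ W mK(1) S(1)] "next")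
  from lzmw_cost_first_phrase[OF h cost this]
  have "lzmw_cost \<sigma> r C (core (Suc m) # ws) (run_cost (Suc m) + c)"
    by (simp only: core_split[OF j] run add.assoc)
  then show ?thesis by (simp only: m[symmetric])
qed

text \<open>A header of round \<open>j\<close> is what the previous round left at
  \<open>4 * K + n\<close>, of body length \<open>2 * j\<close>, plus one letter: the damage of a
  round is what the next one builds on. For \<open>j = 0\<close> it starts from a single
  letter.\<close>

lemma headers_cost:
  assumes G: "insertable G" and j: "j < K"
    and "next": "\<And>L C. state L V W B C \<Longrightarrow> \<forall>m<K. L m = 2 * j + 1 \<Longrightarrow> G C ws c"
    and "n \<le> K" "state L V W B C" "\<forall>m<K. L m = (if m < n then 2 * j + 1 else 2 * j)"
  shows "G C (map (header j) [n..<K] @ ws) c"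
  using assms(4-6)
proof (induction n arbitrary: L C rule: inc_induct)
  case base
  then show ?case by (auto intro: "next")
next
  case (step n)
  have n: "n < K" and Ln: "L n = 2 * j" using step by auto
  have h: "header j n = ((4 * K + n) # take (L n) body) @ [K + 2 * j]"
    "header j n = (4 * K + n) # take (Suc (L n)) body"
    using take_body_Suc[of "2 * j"] j Ln by simp_all
  have "length (header j n) \<le> length (core (Suc n))" by simp
  then have "\<not> prefix (long (Suc n)) (header j n)" by (rule not_prefix_long)
  then have 1: "best_match C (((4 * K + n) # take (L n) body) @ [K + 2 * j]) ((4 * K + n) # take (L n) body)"
    using match_header[OF step.prems(1) n, of "[K + 2 * j]"] unfolding h(1) by simp
  have "state (L(n := Suc (L n))) V W B (insert (header j n) C)"
    using state_insert_header[OF step.prems(1) n] unfolding h(2) .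
  then have "G (insert (header j n) C) (map (header j) [Suc n..<K] @ ws) c"
    using step.prems(2) Ln by (intro step.IH) auto
  then have "G C (header j n # map (header j) [Suc n..<K] @ ws) c"
    using insertableD[OF G 1] unfolding h(1) by simp
  then show ?case using n by (simp add: upt_conv_Cons)
qed

lemma exits_cost:
  assumes G: "insertable G" and j: "j < K"
    and "next": "\<And>W C. state L V W B C \<Longrightarrow> \<forall>m<K. (Suc j, m) \<in> W \<Longrightarrow> \<forall>x\<in>W. fst x \<le> Suc j \<Longrightarrow> G C ws c"
    and V: "\<forall>x\<in>V. fst x \<le> j"
    and "n \<le> K" "state L V W B C" "\<forall>m<n. (Suc j, m) \<in> W" "\<forall>x\<in>W. fst x \<le> Suc j \<and> (fst x = Suc j \<longrightarrow> snd x < n)"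
  shows "G C (map (\<lambda>m. tail (Suc j) @ [6 * K + m]) [n..<K] @ ws) c"
  using assms(5-8)
proof (induction n arbitrary: W C rule: inc_induct)
  case base
  then show ?case by (auto intro: "next")
next
  case (step n)
  have VW: "(Suc j, n) \<notin> V" "(Suc j, n) \<notin> W" using V step.prems(3) by fastforce+
  have "state L V (insert (Suc j, n) W) B (insert (tail (Suc j) @ [6 * K + n]) C)"
    using state_insert_exit[OF step.prems(1)] j by simp
  then have "G (insert (tail (Suc j) @ [6 * K + n]) C) (map (\<lambda>m. tail (Suc j) @ [6 * K + m]) [Suc n..<K] @ ws) c"
    using step.prems by (intro step.IH) (auto simp: less_Suc_eq)
  then have "G C ((tail (Suc j) @ [6 * K + n]) # map (\<lambda>m. tail (Suc j) @ [6 * K + m]) [Suc n..<K] @ ws) c"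
    using match_tail[OF step.prems(1) _ _ VW, of "[]"] j by (intro insertableD[OF G]) auto
  then show ?case using step by (simp add: upt_conv_Cons)
qed

section \<open>The \<open>K\<close> rounds in sequence\<close>

definition lzd_stage :: "nat \<Rightarrow> nat list list" where
  "lzd_stage j = map (header j) [0..<K] @ [core K]"

text \<open>For LZMW the exits are inserted beforehand together with \<open>6 * K + m\<close>.
  Otherwise \<open>[6 * K + m]\<close> would become a phrase of its own, and its join with the next
  header could be matched in later rounds.\<close>

definition lzmw_stage :: "nat \<Rightarrow> nat list list" where
  "lzmw_stage j = map (header j) [0..<K] @ map (\<lambda>m. tail (Suc j) @ [6 * K + m]) [0..<K] @ [core K]"

definition segments :: "(nat \<Rightarrow> nat list list) \<Rightarrow> nat list list" where
  "segments stage = tail_segments K @ long_segments 0 @ concat (map stage [0..<K])"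

lemma insertable_lzd: "insertable (lzd_cost \<sigma> r)"
  unfolding insertable_def by (intro allI impI) (rule lzd_cost_insert)

lemma insertable_lzmw: "insertable (lzmw_cost \<sigma> r)"
  unfolding insertable_def by (intro allI impI) (rule lzmw_cost_insert)

text \<open>Round \<open>j\<close> uses exits of index \<open>Suc j\<close>, whereas
  \<open>V\<close> holds only smaller indices when the round starts, so prolonged exits do not
  interfere.\<close>

lemma lzd_stages:
  "j \<le> K \<Longrightarrow> state L V {} {} C \<Longrightarrow> \<forall>m<K. L m = 2 * j \<Longrightarrow> \<forall>x\<in>V. fst x \<le> j \<Longrightarrow>
    lzd_cost \<sigma> r C (concat (map lzd_stage [j..<K])) ((K - j) * run_cost K)"
proof (induction j arbitrary: L V C rule: inc_induct)
  case base
  then show ?case by (simp add: lzd_cost_Nil)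
next
  case (step j)
  have j: "j < K" using step by simp
  let ?ws = "concat (map lzd_stage [Suc j..<K])" and ?c = "(K - Suc j) * run_cost K"
  have run: "lzd_cost \<sigma> r C' (core K # ?ws) (run_cost K + ?c)"
    if "state L' V {} {} C'" "\<forall>m<K. L' m = 2 * j + 1" for L' C'
  proof (rule lzd_run[OF j _ order_refl that(1)])
    fix L V C assume "state L V {} {} C" "\<forall>m<K. L m = 2 * j + 2" "\<forall>x\<in>V. fst x \<le> Suc j"
    then show "lzd_cost \<sigma> r C ?ws ?c" by (intro step.IH) auto
  next
    show "\<forall>x\<in>V. fst x \<le> Suc j \<and> (fst x = Suc j \<longrightarrow> K \<le> snd x)"
    proof
      fix x assume "x \<in> V"
      then have "fst x \<le> j" using step.prems(3) by blast
      then show "fst x \<le> Suc j \<and> (fst x = Suc j \<longrightarrow> K \<le> snd x)" by simp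
    qed
  qed (use that in auto)
  note G = insertable_lzd
  have "lzd_cost \<sigma> r C (map (header j) [0..<K] @ core K # ?ws) (run_cost K + ?c)"
  proof (rule headers_cost[OF G j _ le0 step.prems(1)])
    show "\<forall>m<K. L m = (if m < 0 then 2 * j + 1 else 2 * j)" using step.prems(2) by simp
  qed (rule run)
  moreover have "run_cost K + ?c = (K - j) * run_cost K"
    using j by (metis Suc_diff_Suc mult_Suc)
  moreover have "concat (map lzd_stage [j..<K]) = lzd_stage j @ ?ws" using j by (simp add: upt_conv_Cons)
  ultimately show ?case by (simp only: lzd_stage_def[of j] append.assoc append_Cons append_Nil)
qed

lemma lzmw_stages:
  "j \<le> K \<Longrightarrow> state L V W B C \<Longrightarrow> \<forall>m<K. L m = 2 * j \<Longrightarrow> \<forall>x\<in>V \<union> W \<union> B. fst x \<le> j \<Longrightarrow>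
    lzmw_cost \<sigma> r C (concat (map lzmw_stage [j..<K])) ((K - j) * run_cost K)"
proof (induction j arbitrary: L V W B C rule: inc_induct)
  case base
  then show ?case by (simp add: lzmw_cost_Nil)
next
  case (step j)
  have j: "j < K" using step by simp
  let ?ws = "concat (map lzmw_stage [Suc j..<K])" and ?c = "(K - Suc j) * run_cost K"
  note G = insertable_lzmw
  have run: "lzmw_cost \<sigma> r C' (core K # ?ws) (run_cost K + ?c)"
    if S: "state L' V W' B C'" "\<forall>m<K. L' m = 2 * j + 1" "\<forall>m<K. (Suc j, m) \<in> W'" "\<forall>x\<in>W'. fst x \<le> Suc j"
    for L' W' C'
  proof (rule lzmw_run[OF j _ S(3,1,2)])
    fix L V B C assume "state L V W' B C" "\<forall>m<K. L m = 2 * j + 2" "\<forall>x\<in>V \<union> B. fst x \<le> Suc j"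
    then show "lzmw_cost \<sigma> r C ?ws ?c" using S(4) by (intro step.IH) auto
  qed (use step.prems in auto)
  have exits: "lzmw_cost \<sigma> r C' (map (\<lambda>m. tail (Suc j) @ [6 * K + m]) [0..<K] @ core K # ?ws) (run_cost K + ?c)"
    if S: "state L' V W B C'" "\<forall>m<K. L' m = 2 * j + 1" for L' C'
  proof (rule exits_cost[OF G j _ _ le0 S(1)])
    fix W' C'' assume "state L' V W' B C''" "\<forall>m<K. (Suc j, m) \<in> W'" "\<forall>x\<in>W'. fst x \<le> Suc j"
    then show "lzmw_cost \<sigma> r C'' (core K # ?ws) (run_cost K + ?c)" using S(2) run by blast
  next
    show "\<forall>x\<in>V. fst x \<le> j" using step.prems(3) by blast
  next
    show "\<forall>x\<in>W. fst x \<le> Suc j \<and> (fst x = Suc j \<longrightarrow> snd x < 0)"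
    proof
      fix x assume "x \<in> W"
      then have "fst x \<le> j" using step.prems(3) by blast
      then show "fst x \<le> Suc j \<and> (fst x = Suc j \<longrightarrow> snd x < 0)" by simp
    qed
  qed simp
  have "lzmw_cost \<sigma> r C (map (header j) [0..<K] @
      map (\<lambda>m. tail (Suc j) @ [6 * K + m]) [0..<K] @ core K # ?ws) (run_cost K + ?c)"
  proof (rule headers_cost[OF G j _ le0 step.prems(1)])
    show "\<forall>m<K. L m = (if m < 0 then 2 * j + 1 else 2 * j)" using step.prems(2) by simp
  qed (rule exits)
  moreover have "run_cost K + ?c = (K - j) * run_cost K"
    using j by (metis Suc_diff_Suc mult_Suc)
  moreover have "concat (map lzmw_stage [j..<K]) = lzmw_stage j @ ?ws" using j by (simp add: upt_conv_Cons)
  ultimately show ?case by (simp only: lzmw_stage_def[of j] append.assoc append_Cons append_Nil)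
qed

lemma segments_cost:
  assumes "insertable G" "G (longs K) (concat (map stage [0..<K])) c"
  shows "G {} (segments stage) c"
proof -
  have "G (longs 0) (long_segments 0 @ concat (map stage [0..<K])) c"
    by (rule longs_cost[OF assms le0])
  moreover have "longs 0 = tails 0" by (simp add: longs_def)
  ultimately have "G (tails 0) (long_segments 0 @ concat (map stage [0..<K])) c" by simp
  then have "G (tails K) (segments stage) c"
    unfolding segments_def by (rule tails_cost[OF assms(1) _ order_refl])
  \<comment> \<open>\<open>tails K\<close> is empty: at the start no entry is controlled.\<close>
  then show ?thesis by (simp add: tails_def)
qed

lemma lzd_segments_cost: "lzd_cost \<sigma> r {} (segments lzd_stage) (K * run_cost K)"
proof (rule segments_cost[OF insertable_lzd])
  show "lzd_cost \<sigma> r (longs K) (concat (map lzd_stage [0..<K])) (K * run_cost K)"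
    using lzd_stages[OF le0 state_longs, of \<sigma> r] by simp
qed

lemma lzmw_segments_cost: "lzmw_cost \<sigma> r {} (segments lzmw_stage) (K * run_cost K)"
proof (rule segments_cost[OF insertable_lzmw])
  show "lzmw_cost \<sigma> r (longs K) (concat (map lzmw_stage [0..<K])) (K * run_cost K)"
    using lzmw_stages[OF le0 state_longs, of \<sigma> r] by simp
qed

end

section \<open>Length and running time\<close>

lemma length_enc_sep_text:
  assumes "letters_ok \<sigma> ws" "s + 2 * length ws \<le> Suc r"
  shows "length (enc (sep_text s ws)) \<le> \<sigma> * sum_list (map length ws) + 2 * length ws * (r + 1)"
  using assms
proof (induction ws arbitrary: s)
  case (Cons w ws)
  have "length (enc w) \<le> \<sigma> * length w" using Cons.prems by (intro length_enc_le) auto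
  moreover have "length (enc (sep_text (s + 2) ws)) \<le> \<sigma> * sum_list (map length ws) + 2 * length ws * (r + 1)"
    using Cons by (intro Cons.IH) auto
  ultimately show ?case using Cons.prems by (simp add: algebra_simps)
qed simp

lemma naive_lzd_time_sep_text:
  assumes "lzd_cost \<sigma> r {} ws c" "0 < \<sigma>" "r = \<sigma> + 2 * length ws" "letters_ok \<sigma> ws"
  shows "c \<le> naive_lzd_time (enc [1..<Suc r] @ enc (sep_text \<sigma> ws))"
proof (rule naive_lzd_time_enc_ge)
  have "dict_inv \<sigma> r \<sigma> {} ((\<lambda>a. [a]) ` {..r})" by (auto simp: dict_inv_def)
  then show "lzd_lb (lzd_alphabet r) (enc (sep_text \<sigma> ws)) c"
    using assms unfolding lzd_alphabet_eq lzd_cost_def by simp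
qed (use assms in simp)

text \<open>The preamble ends with the phrase \<open>code r\<close>. The extra letter
  \<open>\<sigma>\<close> shields the first segment from it: their join contains a used separator,
  and \<open>[\<sigma>]\<close> is the previous phrase from then on.\<close>

lemma naive_lzmw_time_sep_text:
  assumes "lzmw_cost \<sigma> r {} ws c" "0 < \<sigma>" "r = Suc \<sigma> + 2 * length ws" "letters_ok \<sigma> ws"
  shows "c \<le> naive_lzmw_time (False # True # lzmw_preamble r @ enc (\<sigma> # sep_text (Suc \<sigma>) ws))"
proof (rule naive_lzmw_time_enc_ge)
  let ?D = "(\<lambda>a. [a]) ` {..Suc r}"
  let ?y = "sep_text (Suc \<sigma>) ws"
  have D: "dict_inv \<sigma> r \<sigma> {} ?D" by (auto simp: dict_inv_def)
  have y: "0 < a \<and> (a < \<sigma> \<or> Suc \<sigma> \<le> a)" if "a \<in> set ?y" for a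
    using set_sep_text[OF assms(4) _ that] by simp
  have 1: "is_longest ?D ([\<sigma>] @ ?y) [\<sigma>]"
    using separator_is_longest[OF D, of ?y] y assms(3) by fastforce
  have "dict_inv \<sigma> r (Suc \<sigma>) {} (insert ([r] @ [\<sigma>]) ?D)"
    by (rule dict_inv_insert_used[OF D]) auto
  then have "lzmw_lb (lzmw_junk r \<union> enc ` insert ([r] @ [\<sigma>]) ?D) (enc [\<sigma>]) (enc ?y) c"
    using assms by (intro assms(1)[unfolded lzmw_cost_def, rule_format]) auto
  then have "lzmw_lb (lzmw_junk r \<union> enc ` ?D) (enc [r]) (enc ([\<sigma>] @ ?y)) (0 + c)"
    using assms(2) y by (intro lzmw_lb_enc_step[OF 1]) (auto simp: agrees_def)
  then show "lzmw_lb (lzmw_alphabet r) (code r) (enc (\<sigma> # ?y)) c"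
    by (simp add: lzmw_alphabet_eq)
qed

lemma length_lzmw_preamble: "length (lzmw_preamble r) = r * (r + 3)"
  by (induction r) (simp_all add: add_mult_distrib2 add_mult_distrib)

lemma length_enc_upt: "length (enc [1..<Suc r]) \<le> (r + 1) * r"
proof -
  have "length (enc [1..<Suc r]) \<le> (r + 1) * length [1..<Suc r]"
    by (rule length_enc_le) auto
  then show ?thesis by (simp del: upt_Suc)
qed

lemma sum_list_map_length_concat: "sum_list (map length (concat xss)) = sum_list (map (\<lambda>xs. sum_list (map length xs)) xss)"
  by (induction xss) auto

context hard_text
begin

lemma set_tail: "a \<in> set (tail k) \<Longrightarrow> K \<le> a \<and> a \<le> 3 * K"
  by (auto simp: tail_def)

text \<open>The largest letter is the terminator \<open>8 * K\<close>, so \<open>9 * K\<close> can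
  be the first separator.\<close>

lemma letters_ok_segments:
  assumes "\<And>j. j < K \<Longrightarrow> letters_ok (9 * K) (stage j)"
  shows "letters_ok (9 * K) (segments stage)"
proof -
  have "letters_ok (9 * K) (tail_segments n)" if "n \<le> K" for n
    using that
  proof (induction n)
    case (Suc n)
    then show ?case using K_pos set_tail[of _ n] by fastforce
  qed (simp add: letters_ok_def)
  moreover
  have long: "0 < a \<and> a < 9 * K" if "a \<in> set (long m)" "m \<le> K" for a m
    using that set_core[of m a] K_pos by (auto simp: long_def)
  have "letters_ok (9 * K) (long_segments 0)"
    unfolding letters_ok_def
  proof (intro ballI)
    fix w a assume "w \<in> set (long_segments 0)" "a \<in> set w"
    then obtain m where "m < K" "a \<in> set body \<union> {6 * K + m} \<union> set (long m) \<union> set (long (Suc m))"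
      unfolding long_segments_def by (auto simp del: core.simps)
    then show "0 < a \<and> a < 9 * K"
      using long[of a m] long[of a "Suc m"] set_tail[of a 0] K_pos by auto
  qed
  moreover have "letters_ok (9 * K) (concat (map stage [0..<K]))"
    unfolding letters_ok_def
  proof
    fix w assume "w \<in> set (concat (map stage [0..<K]))"
    then obtain j where "j < K" "w \<in> set (stage j)" by auto
    then show "\<forall>a\<in>set w. 0 < a \<and> a < 9 * K" using assms[of j] unfolding letters_ok_def by blast
  qed
  ultimately show ?thesis unfolding segments_def letters_ok_append by blast
qed

lemma header_letters: "m < K \<Longrightarrow> a \<in> set (header j m) \<Longrightarrow> 0 < a \<and> a < 9 * K"
proof -
  assume m: "m < K" and a: "a \<in> set (header j m)"
  consider "a = 4 * K + m" | "a \<in> set body"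
    using a in_set_takeD[of a "2 * j + 1" body] by auto
  then show ?thesis using m K_pos set_tail[of a 0] by cases auto
qed

lemma letters_ok_stages:
  "letters_ok (9 * K) (lzd_stage j)" "letters_ok (9 * K) (lzmw_stage j)"
proof -
  have core: "letters_ok (9 * K) [core K]"
    using set_core[of K] K_pos by (fastforce simp: letters_ok_def)
  have exits: "letters_ok (9 * K) (map (\<lambda>m. tail (Suc j) @ [6 * K + m]) [0..<K])"
    unfolding letters_ok_map using set_tail[of _ "Suc j"] K_pos by fastforce
  have headers: "letters_ok (9 * K) (map (header j) [0..<K])"
    unfolding letters_ok_map using header_letters[of _ _ j] by (metis atLeastLessThan_iff set_upt)
  show "letters_ok (9 * K) (lzd_stage j)"
    unfolding lzd_stage_def letters_ok_append using core headers by (rule conjI[rotated])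
  show "letters_ok (9 * K) (lzmw_stage j)"
    unfolding lzmw_stage_def letters_ok_append using core exits headers by (intro conjI)
qed

section \<open>Number of segments and of letters\<close>

lemma length_tail_segments: "length (tail_segments n) = 2 * n"
  by (induction n) auto

lemma letters_tail_segments: "sum_list (map length (tail_segments n)) \<le> n * (2 * K + 3)"
  by (induction n) (auto simp: length_tail)

lemma letters_long_segments: "sum_list (map length (long_segments 0)) \<le> K * (4 * K ^ 2 + 10 * K + 6)"
proof -
  have len: "length (long m) \<le> 2 * K ^ 2 + 3 * K + 1" if "m \<le> K" for m
    using mult_le_mono1[OF that, of "2 * K + 3"]
    by (simp add: long_def length_core power2_eq_square algebra_simps)
  have "sum_list (map length [body @ [6 * K + m], body @ (6 * K + m) # long m, long (Suc m)])
      \<le> 4 * K ^ 2 + 10 * K + 6" if "m < K" for m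
    using len[of m] len[of "Suc m"] that by (simp add: length_tail)
  then have "sum_list (map (\<lambda>m. sum_list (map length [body @ [6 * K + m], body @ (6 * K + m) # long m, long (Suc m)])) [0..<K])
     \<le> sum_list (map (\<lambda>m. 4 * K ^ 2 + 10 * K + 6) [0..<K])"
    by (intro sum_list_mono) auto
  also have "\<dots> = K * (4 * K ^ 2 + 10 * K + 6)" by (simp add: sum_list_triv)
  finally show ?thesis
    by (simp add: long_segments_def sum_list_map_length_concat o_def)
qed

lemma letters_stage:
  assumes "j < K"
  shows "sum_list (map length (lzd_stage j)) \<le> K * (6 * K + 7)"
    and "sum_list (map length (lzmw_stage j)) \<le> K * (6 * K + 7)"
proof -
  \<comment> \<open>A round has at most \<open>K\<close> headers and \<open>K\<close> exits of at
    most \<open>2 * K + 2\<close> letters each, and the core of \<open>K * (2 * K + 3)\<close>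
    letters; this gives \<open>6 * K + 7\<close>.\<close>
  have 1: "sum_list (map (\<lambda>m. length (header j m)) [0..<K]) \<le> sum_list (map (\<lambda>m. 2 * K + 2) [0..<K])"
    by (intro sum_list_mono) (simp add: length_tail)
  have 2: "sum_list (map (\<lambda>m. length (tail (Suc j) @ [6 * K + m])) [0..<K]) \<le> sum_list (map (\<lambda>m. 2 * K + 2) [0..<K])"
    by (intro sum_list_mono) (simp add: length_tail)
  have 3: "sum_list (map (\<lambda>m. 2 * K + 2) [0..<K]) = K * (2 * K + 2)" by (simp add: sum_list_triv)
  show "sum_list (map length (lzd_stage j)) \<le> K * (6 * K + 7)"
    using 1 3 by (simp add: lzd_stage_def o_def length_core algebra_simps)
  show "sum_list (map length (lzmw_stage j)) \<le> K * (6 * K + 7)"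
    using 1 2 3 by (simp add: lzmw_stage_def o_def length_core algebra_simps)
qed

lemma length_stage: "length (lzd_stage j) = K + 1" "length (lzmw_stage j) = 2 * K + 1"
  by (simp_all add: lzd_stage_def lzmw_stage_def)

lemma length_segments_le:
  assumes "\<And>j. length (stage j) \<le> 2 * K + 1"
  shows "length (segments stage) \<le> 8 * K ^ 2"
proof -
  have "length (long_segments 0) = 3 * K"
    by (simp add: long_segments_def length_concat o_def sum_list_triv)
  moreover have "sum_list (map (\<lambda>j. length (stage j)) [0..<K]) \<le> sum_list (map (\<lambda>j. 2 * K + 1) [0..<K])"
    using assms by (intro sum_list_mono) auto
  then have "length (concat (map stage [0..<K])) \<le> K * (2 * K + 1)"
    by (simp add: length_concat o_def sum_list_triv)
  then have "length (concat (map stage [0..<K])) \<le> 2 * K ^ 2 + K"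
    by (simp add: power2_eq_square algebra_simps)
  moreover have "K \<le> K ^ 2" using K_pos by (simp add: power2_eq_square)
  ultimately show ?thesis
    by (simp add: segments_def length_tail_segments)
qed

lemma letters_segments_le:
  assumes "\<And>j. j < K \<Longrightarrow> sum_list (map length (stage j)) \<le> K * (6 * K + 7)"
  shows "sum_list (map length (segments stage)) \<le> 38 * K ^ 3"
proof -
  have "sum_list (map (\<lambda>j. sum_list (map length (stage j))) [0..<K]) \<le> sum_list (map (\<lambda>j. K * (6 * K + 7)) [0..<K])"
    using assms by (intro sum_list_mono) auto
  then have "sum_list (map length (concat (map stage [0..<K]))) \<le> K * (K * (6 * K + 7))"
    by (simp add: sum_list_map_length_concat o_def sum_list_triv)
  then have "sum_list (map length (segments stage)) \<le>
      K * (2 * K + 3) + K * (4 * K ^ 2 + 10 * K + 6) + K * (K * (6 * K + 7))"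
    unfolding segments_def using letters_tail_segments[of K] letters_long_segments by simp
  also have "\<dots> = 10 * K ^ 3 + 19 * K ^ 2 + 9 * K"
    by (simp add: power2_eq_square power3_eq_cube algebra_simps)
  \<comment> \<open>\<open>38\<close> is \<open>10 + 19 + 9\<close>.\<close>
  also have "\<dots> \<le> 38 * K ^ 3"
  proof -
    have "K ^ 2 \<le> K ^ 3" "K \<le> K ^ 3"
      using K_pos power_increasing[of 2 3 K] power_increasing[of 1 3 K] by simp_all
    then show ?thesis by linarith
  qed
  finally show ?thesis .
qed

text \<open>Twice \<open>run_cost n\<close> is \<open>K * (2 * K + 3) * n * (n + 1)\<close>; the
  induction weakens \<open>n * (n + 1)\<close> to \<open>n ^ 2\<close>.\<close>

lemma run_cost_ge: "K ^ 4 \<le> run_cost K"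
proof -
  have "n ^ 2 * (K * (2 * K + 3)) \<le> 2 * run_cost n" for n
  proof (induction n)
    case (Suc n)
    have "Suc n ^ 2 \<le> n ^ 2 + 2 * Suc n" by (simp add: power2_eq_square)
    then have "Suc n ^ 2 * (K * (2 * K + 3)) \<le> (n ^ 2 + 2 * Suc n) * (K * (2 * K + 3))"
      by (rule mult_le_mono1)
    also have "\<dots> = n ^ 2 * (K * (2 * K + 3)) + 2 * (K * length (core (Suc n)))"
      unfolding length_core by (simp add: algebra_simps)
    also have "\<dots> \<le> 2 * run_cost (Suc n)"
      using Suc by (simp add: run_cost_def del: core.simps)
    finally show ?case .
  qed (simp add: run_cost_def)
  from this[of K] have "2 * K ^ 4 \<le> 2 * run_cost K"
    by (simp add: power_numeral_reduce algebra_simps)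
  then show ?thesis by simp
qed

text \<open>One bound for both texts: the summands are the preamble, the two initial bits and extra
  separator of LZMW, and the separated segments.\<close>

lemma long_text_bound:
  fixes r l q n :: nat
  assumes "q \<le> 38 * K ^ 3" "l \<le> 8 * K ^ 2" "r \<le> 9 * K + 1 + 2 * l"
    "n \<le> r * (r + 3) + (2 + 9 * K + 1) + (9 * K * q + 2 * l * (r + 1))"
  shows "n \<le> 2000 * K ^ 4"
proof -
  have pw: "K \<le> K ^ 2" "1 \<le> K ^ 2" "1 \<le> K ^ 4" "K \<le> K ^ 4" "K ^ 2 \<le> K ^ 4"
    using K_pos power_increasing[of 1 2 K] power_increasing[of 1 4 K] power_increasing[of 2 4 K] by simp_all
  \<comment> \<open>\<open>26\<close> is \<open>9 + 1 + 2 * 8\<close>. The products below use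
    \<open>26 + 3\<close>, \<open>26 + 1\<close> and \<open>2 * 8\<close>; the total
    \<open>754 + 12 + 342 + 432\<close> is below \<open>2000\<close>.\<close>
  have r: "r \<le> 26 * K ^ 2" using assms pw by linarith
  have e: "26 * K ^ 2 * (29 * K ^ 2) = 754 * K ^ 4" "9 * K * (38 * K ^ 3) = 342 * K ^ 4"
    "16 * K ^ 2 * (27 * K ^ 2) = 432 * K ^ 4"
    by (simp_all add: power_numeral_reduce)
  have "r * (r + 3) \<le> 754 * K ^ 4"
    unfolding e[symmetric] by (rule mult_le_mono) (use r pw in linarith)+
  moreover have "9 * K * q \<le> 342 * K ^ 4"
    unfolding e[symmetric] using assms(1) by (rule mult_le_mono2)
  moreover have "2 * l * (r + 1) \<le> 432 * K ^ 4"
    unfolding e[symmetric] by (rule mult_le_mono) (use assms(2) r pw in linarith)+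
  moreover have "2 + 9 * K + 1 \<le> 12 * K ^ 4" using pw by linarith
  ultimately have "n \<le> 754 * K ^ 4 + 12 * K ^ 4 + (342 * K ^ 4 + 432 * K ^ 4)"
    using assms(4) by (meson add_mono le_trans)
  then show ?thesis by simp
qed

lemma lzd_text: "\<exists>s::bool list. K \<le> length s \<and> length s \<le> 2000 * K ^ 4 \<and> K ^ 5 \<le> naive_lzd_time s"
proof -
  let ?ws = "segments lzd_stage"
  define r where "r = 9 * K + 2 * length ?ws"
  have r: "r \<le> 9 * K + 1 + 2 * length ?ws" by (simp add: r_def)
  let ?s = "enc [1..<Suc r] @ enc (sep_text (9 * K) ?ws)"
  have ok: "letters_ok (9 * K) ?ws" using letters_ok_segments letters_ok_stages by blast
  have l: "length ?ws \<le> 8 * K ^ 2" by (rule length_segments_le) (simp add: length_stage)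
  have q: "sum_list (map length ?ws) \<le> 38 * K ^ 3" using letters_segments_le letters_stage by blast
  have "length (enc [1..<Suc r]) \<le> r * (r + 3)"
    using length_enc_upt[of r] by (simp add: algebra_simps)
  moreover have "length (enc (sep_text (9 * K) ?ws)) \<le>
      9 * K * sum_list (map length ?ws) + 2 * length ?ws * (r + 1)"
    by (rule length_enc_sep_text[OF ok]) (simp add: r_def)
  ultimately have len: "length ?s \<le> 2000 * K ^ 4"
    using r by (intro long_text_bound[OF q l r]) (simp del: upt_Suc)
  have low: "K \<le> length ?s"
    using length_enc_ge[of "[1..<Suc r]" 1] by (simp add: r_def del: upt_Suc)
  have time: "K * run_cost K \<le> naive_lzd_time ?s"
    by (rule naive_lzd_time_sep_text[OF lzd_segments_cost _ r_def ok]) (use K_pos in simp)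
  have pow: "K ^ 5 \<le> K * run_cost K"
    using mult_le_mono2[OF run_cost_ge, of K] by (simp add: power_numeral_reduce)
  show ?thesis by (intro exI[of _ ?s] conjI low len order_trans[OF pow time])
qed

lemma lzmw_text: "\<exists>s::bool list. K \<le> length s \<and> length s \<le> 2000 * K ^ 4 \<and> K ^ 5 \<le> naive_lzmw_time s"
proof -
  let ?ws = "segments lzmw_stage"
  define r where "r = Suc (9 * K) + 2 * length ?ws"
  have r: "r \<le> 9 * K + 1 + 2 * length ?ws" by (simp add: r_def)
  let ?s = "False # True # lzmw_preamble r @ enc (9 * K # sep_text (Suc (9 * K)) ?ws)"
  have ok: "letters_ok (9 * K) ?ws" using letters_ok_segments letters_ok_stages by blast
  have l: "length ?ws \<le> 8 * K ^ 2" by (rule length_segments_le) (simp add: length_stage)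
  have q: "sum_list (map length ?ws) \<le> 38 * K ^ 3" using letters_segments_le letters_stage by blast
  have "length (enc (sep_text (Suc (9 * K)) ?ws)) \<le>
      9 * K * sum_list (map length ?ws) + 2 * length ?ws * (r + 1)"
    by (rule length_enc_sep_text[OF ok]) (simp add: r_def)
  then have len: "length ?s \<le> 2000 * K ^ 4"
    using r by (intro long_text_bound[OF q l r]) (simp add: length_lzmw_preamble)
  have low: "K \<le> length ?s" by simp
  have time: "K * run_cost K \<le> naive_lzmw_time ?s"
    by (rule naive_lzmw_time_sep_text[OF lzmw_segments_cost _ r_def ok]) (use K_pos in simp)
  have pow: "K ^ 5 \<le> K * run_cost K"
    using mult_le_mono2[OF run_cost_ge, of K] by (simp add: power_numeral_reduce)
  show ?thesis by (intro exI[of _ ?s] conjI low len order_trans[OF pow time])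
qed

end

section \<open>From the parameter \<open>K\<close> to the text length\<close>

lemma superlinear_bound:
  fixes f :: "bool list \<Rightarrow> nat"
  assumes "\<And>K::nat. 0 < K \<Longrightarrow> \<exists>s. K \<le> length s \<and> length s \<le> 2000 * K ^ 4 \<and> K ^ 5 \<le> f s"
  shows "\<exists>c::real. c > 0 \<and> (\<forall>N::nat. \<exists>n\<ge>N. \<exists>s::bool list. length s = n \<and>
         real (f s) \<ge> c * (real n powr (5/4) / ln (real n) powr (1/4)))"
proof (rule exI[of _ "1 / 2000 powr (5/4)"], rule conjI, simp, rule allI)
  \<comment> \<open>A length of at most \<open>2000 * K ^ 4\<close> makes \<open>K ^ 5\<close> at
    least \<open>?c\<close> times the power \<open>5/4\<close> of the length; dividing by a power of
    a logarithm that is at least 1 only lowers the bound.\<close>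
  let ?c = "1 / 2000 powr (5/4) :: real"
  fix N :: nat
  \<comment> \<open>The summand \<open>N\<close> makes the text long enough; the summand
    \<open>3\<close> exceeds Euler's number, so the logarithm is at least 1.\<close>
  define K where "K = N + 3"
  obtain s :: "bool list" where s: "K \<le> length s" "length s \<le> 2000 * K ^ 4" "K ^ 5 \<le> f s"
    using assms[of K] by (auto simp: K_def)
  let ?n = "real (length s)"
  have n3: "?n \<ge> 3" using s(1) by (simp add: K_def)
  then have "ln ?n \<ge> ln 3" by (intro ln_mono) auto
  moreover have "ln (3::real) \<ge> 1"
    using exp_le by (simp add: ln_ge_iff)
  ultimately have ln1: "ln ?n \<ge> 1" by simp
  then have "ln ?n powr (1/4) \<ge> 1" by (intro ge_one_powr_ge_zero) auto
  then have "?n powr (5/4) / ln ?n powr (1/4) \<le> ?n powr (5/4)"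
    using divide_left_mono[of 1 "ln ?n powr (1/4)" "?n powr (5/4)"] ln1 by simp
  also have "\<dots> \<le> (2000 * real K ^ 4) powr (5/4)"
  proof (rule powr_mono2)
    show "?n \<le> 2000 * real K ^ 4"
      using of_nat_mono[OF s(2), where 'a = real] by simp
  qed auto
  also have "\<dots> = 2000 powr (5/4) * (real K ^ 4) powr (5/4)" by (simp add: powr_mult)
  also have "(real K ^ 4) powr (5/4) = real K ^ 5"
  proof -
    have K: "0 < real K" by (simp add: K_def)
    have "(real K ^ 4) powr (5/4) = (real K powr real 4) powr (5/4)" by (simp only: powr_realpow[OF K])
    also have "\<dots> = real K powr real 5" by (simp only: powr_powr) simp
    also have "\<dots> = real K ^ 5" by (simp only: powr_realpow[OF K])
    finally show ?thesis .
  qed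
  finally have "?c * (?n powr (5/4) / ln ?n powr (1/4)) \<le> ?c * (2000 powr (5/4) * real K ^ 5)"
    by (rule mult_left_mono) auto
  also have "\<dots> = real K ^ 5" by simp
  also have "\<dots> \<le> real (f s)" using of_nat_mono[OF s(3), where 'a = real] by simp
  finally show "\<exists>n\<ge>N. \<exists>s::bool list. length s = n \<and>
      ?c * (real n powr (5/4) / ln (real n) powr (1/4)) \<le> real (f s)"
    using s(1) by (intro exI[of _ "length s"] conjI exI[of _ s]) (auto simp: K_def)
qed

theorem theorem4:
  "(\<exists>c::real. c > 0 \<and>
      (\<forall>N::nat. \<exists>n\<ge>N. \<exists>s::bool list. length s = n \<and>
         real (naive_lzd_time s) \<ge> c * (real n powr (5/4) / ln (real n) powr (1/4)))) \<and>
   (\<exists>c::real. c > 0 \<and>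
      (\<forall>N::nat. \<exists>n\<ge>N. \<exists>s::bool list. length s = n \<and>
         real (naive_lzmw_time s) \<ge> c * (real n powr (5/4) / ln (real n) powr (1/4))))"
  by (rule conjI[OF superlinear_bound[of naive_lzd_time, OF hard_text.lzd_text[OF hard_text.intro]]
      superlinear_bound[of naive_lzmw_time, OF hard_text.lzmw_text[OF hard_text.intro]]])

end
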